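(* Let $X$ be a smooth compact toric symplectic manifold with Delzant moment polytope $P=\bigcap_{i=1}^n\{d\in N_{\mathbb R}\mid\langle v_i,d\rangle+c_i\ge0\}$ (one half-space for each facet, $v_i\in M$ the primitive inward normals, $c_i\in\mathbb R$), and let $W_X=\sum_{i=1}^nt^{c_i}x^{v_i}$. Then the tropical critical point $d_{\mathrm{crit}}$ of $W_X$ agrees with the special point $u_0$ of $P$ constructed by Fukaya, Oh, Ohta and Ono. In particular $u_0$ is the unique point of $N_{\mathbb R}$ arising as the valuation of a critical point of $W_X$ in $T(\mathbf K_{>0})$.
   Context: $M\cong\mathbb Z^r$ and $N$ are dual lattices with pairing $\langle\ ,\ \rangle$; $M_{\mathbb R}=M\otimes\mathbb R$, $N_{\mathbb R}=N\otimes\mathbb R$. A Delzant polytope in $N_{\mathbb R}$ is an ($r$-dimensional) polytope each of whose vertices lies on exactly $r$ edges, whose directions can be represented by a $\mathbb Z$-basis of $N$; these are the moment polytopes of compact toric symplectic manifolds. $\mathbf K$ is the field of generalised Puiseux series $\sum_kc_{\mu_k}t^{\mu_k}$, $c_{\mu_k}\in\mathbb C$, with real exponents forming a strictly increasing sequence that is finite or tends to $+\infty$; $\operatorname{Val}_{\mathbf K}$ is the lowest exponent with nonzero coefficient; $\mathbf K_{>0}$ is the set of nonzero series with leading coefficient in $\mathbb R_{>0}$. $T$ is the split torus over $\mathbf K$ with character lattice $M$; $T(\mathbf K_{>0})=\operatorname{Hom}(M,\mathbf K_{>0})$; the valuation $\operatorname{Val}_T(p)\in N_{\mathbb R}$ is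 determined by $\operatorname{Val}_{\mathbf K}(p^v)=\langle v,\operatorname{Val}_T(p)\rangle$ for all $v\in M$. A critical point of $W_X$ is a $p$ with $\sum_it^{c_i}\langle v_i,u\rangle p^{v_i}=0$ for all $u\in N$. Since $\operatorname{ConvexHull}(\{v_i\})$ is full-dimensional with $0$ in its interior, $W_X$ has a unique critical point $p_{\mathrm{crit}}$ in $T(\mathbf K_{>0})$, and $d_{\mathrm{crit}}:=\operatorname{Val}_T(p_{\mathrm{crit}})$. The point $u_0$: write $\ell_i(d)=\langle v_i,d\rangle+c_i$. Put $P_0=P$, $I_0=\emptyset$. Given the convex polytope $P_k$ and index sets $I_0,\dots,I_k$, if $P_k$ is not a single point let $s_{k+1}(d)=\min\{\ell_i(d)\mid i\notin I_0\cup\dots\cup I_k\}$ for $d$ in the relative interior $\operatorname{Int}P_k$, let $S_{k+1}=\sup_{\operatorname{Int}P_k}s_{k+1}$, let $P_{k+1}=\{d\in\operatorname{Int}P_k\mid s_{k+1}(d)=S_{k+1}\}$ and let $I_{k+1}$ be the set of $i\notin I_0\cup\dots\cup I_k$ with $\ell_i\equiv S_{k+1}$ on $P_{k+1}$. After finitely many steps one reaches a $P_K$ consisting of a single point, and $u_0$ is that point. *)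

theory Defs
  imports "HOL-Analysis.Analysis" "HOL-Library.Poly_Mapping"
begin

section \<open>Generalised Puiseux series\<close>

definition supp :: "(real \<Rightarrow> complex) \<Rightarrow> real set" where
  "supp f = {x. f x \<noteq> 0}"

definition admissible_exponents :: "real set \<Rightarrow> bool" where
  "admissible_exponents S \<longleftrightarrow> finite S \<or>
     (\<exists>\<mu> :: nat \<Rightarrow> real. strict_mono \<mu> \<and> filterlim \<mu> at_top sequentially \<and> S = range \<mu>)"

lemma admissible_exponents_iff:
  "admissible_exponents S \<longleftrightarrow> (\<forall>b. finite {x \<in> S. x \<le> b})"
proof
  assume "admissible_exponents S"
  then consider "finite S"
    | \<mu> :: "nat \<Rightarrow> real" where "strict_mono \<mu>" "filterlim \<mu> at_top sequentially" "S = range \<mu>"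
    unfolding admissible_exponents_def by blast
  then show "\<forall>b. finite {x \<in> S. x \<le> b}"
  proof cases
    case 1
    then show ?thesis by simp
  next
    case 2
    show ?thesis
    proof
      fix b
      have "eventually (\<lambda>n. b < \<mu> n) sequentially"
        using 2(2) by (simp add: filterlim_at_top_dense)
      then obtain N where N: "\<And>n. n \<ge> N \<Longrightarrow> b < \<mu> n"
        by (auto simp: eventually_sequentially)
      have "{x \<in> S. x \<le> b} \<subseteq> \<mu> ` {..<N}"
        using N 2(3) by (force simp: not_le[symmetric])
      then show "finite {x \<in> S. x \<le> b}"
        by (rule finite_subset) simp
    qed
  qed
next
  assume fin: "\<forall>b. finite {x \<in> S. x \<le> b}"
  show "admissible_exponents S"
  proof (cases "finite S")
    case True
    then show ?thesis by (simp add: admissible_exponents_def)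
  next
    case False
    have least: "\<exists>m. m \<in> S \<and> Q m \<and> (\<forall>y\<in>S. Q y \<longrightarrow> m \<le> y)" if "x \<in> S" "Q x" for Q x
    proof -
      let ?A = "{y \<in> S. y \<le> x \<and> Q y}"
      have "?A \<subseteq> {y \<in> S. y \<le> x}" by auto
      then have f: "finite ?A" using fin finite_subset by blast
      have ne: "?A \<noteq> {}" using that by auto
      have "Min ?A \<in> ?A" using Min_in[OF f ne] .
      moreover have "Min ?A \<le> y" if "y \<in> S" "Q y" for y
      proof (cases "y \<le> x")
        case True
        then show ?thesis using that f by (intro Min_le) auto
      next
        case False
        then show ?thesis using calculation by auto
      qed
      ultimately show ?thesis by blast
    qed
    have unbounded: "\<exists>x\<in>S. b < x" for b
    proof (rule ccontr)
      assume "\<not> ?thesis"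
      then have "S = {x \<in> S. x \<le> b}" by force
      then show False using False fin by metis
    qed
    obtain x0 where x0: "x0 \<in> S" "\<And>y. y \<in> S \<Longrightarrow> x0 \<le> y"
      using unbounded[of 0] least[of _ "\<lambda>_. True"] by blast
    have "\<exists>m. m \<in> S \<and> b < m \<and> (\<forall>y\<in>S. b < y \<longrightarrow> m \<le> y)" for b
      using unbounded[of b] least[of _ "\<lambda>y. b < y"] by blast
    then obtain nx where nx: "\<And>b. nx b \<in> S" "\<And>b. b < nx b" "\<And>b y. y \<in> S \<Longrightarrow> b < y \<Longrightarrow> nx b \<le> y"
      by metis
    define \<mu> where "\<mu> n = (nx ^^ n) x0" for n :: nat
    have \<mu>0: "\<mu> 0 = x0" and \<mu>S: "\<mu> (Suc n) = nx (\<mu> n)" for n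
      by (simp_all add: \<mu>_def)
    have mono: "strict_mono \<mu>"
      by (rule strict_mono_Suc_iff[THEN iffD2]) (simp add: \<mu>S nx)
    have inS: "\<mu> n \<in> S" for n
      by (cases n) (simp_all add: \<mu>0 \<mu>S nx x0)
    have escapes: "\<exists>n. b < \<mu> n" for b
    proof (rule ccontr)
      assume "\<not> ?thesis"
      then have "range \<mu> \<subseteq> {x \<in> S. x \<le> b}" using inS by (auto simp: not_less)
      then have "finite (range \<mu>)" using fin finite_subset by blast
      moreover have "infinite (range \<mu>)"
        using strict_mono_imp_inj_on[OF mono] by (simp add: finite_image_iff)
      ultimately show False by simp
    qed
    have "S \<subseteq> range \<mu>"
    proof
      fix x assume x: "x \<in> S"
      show "x \<in> range \<mu>"
      proof (rule ccontr)
        assume nr: "x \<notin> range \<mu>"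
        have "\<mu> n < x" for n
        proof (induction n)
          case 0
          have "\<mu> 0 \<noteq> x" using nr by blast
          then show ?case using x0(2)[OF x] by (simp add: \<mu>0)
        next
          case (Suc n)
          have "\<mu> (Suc n) \<noteq> x" using nr by blast
          then show ?case using nx(3)[OF x Suc] by (simp add: \<mu>S)
        qed
        then show False using escapes[of x] by (meson less_asym)
      qed
    qed
    moreover have "filterlim \<mu> at_top sequentially"
      unfolding filterlim_at_top_dense eventually_sequentially
    proof
      fix b
      obtain N where "b < \<mu> N" using escapes by blast
      moreover have "\<mu> N \<le> \<mu> n" if "n \<ge> N" for n
        using mono that by (simp add: strict_mono_less_eq)
      ultimately show "\<exists>N. \<forall>n\<ge>N. b < \<mu> n" by (meson less_le_trans)
    qed
    ultimately show ?thesis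
      using mono inS unfolding admissible_exponents_def by blast
  qed
qed

typedef puiseux = "{f :: real \<Rightarrow> complex. admissible_exponents (supp f)}"
  morphisms pcoeff Abs_puiseux
  by (rule exI[of _ "\<lambda>_. 0"]) (simp add: admissible_exponents_def supp_def)

lemma puiseux_eqI: "(\<And>x. pcoeff f x = pcoeff g x) \<Longrightarrow> f = g"
  by (simp add: pcoeff_inject[symmetric] fun_eq_iff)

lemma finite_pcoeff_le: "finite {x. pcoeff f x \<noteq> 0 \<and> x \<le> b}"
  using pcoeff[of f] by (simp add: admissible_exponents_iff supp_def)

lemma pcoeff_Abs:
  assumes "\<And>b. finite {x. F x \<noteq> 0 \<and> x \<le> b}"
  shows "pcoeff (Abs_puiseux F) = F"
  by (rule Abs_puiseux_inverse) (simp add: admissible_exponents_iff supp_def assms)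

lemma pcoeff_least:
  assumes "pcoeff f y \<noteq> 0"
  obtains m where "pcoeff f m \<noteq> 0" "\<And>x. pcoeff f x \<noteq> 0 \<Longrightarrow> m \<le> x"
proof -
  let ?A = "{x. pcoeff f x \<noteq> 0 \<and> x \<le> y}"
  have ne: "?A \<noteq> {}" using assms by auto
  have in_A: "Min ?A \<in> ?A" using Min_in[OF finite_pcoeff_le ne] .
  have "Min ?A \<le> x" if "pcoeff f x \<noteq> 0" for x
  proof (cases "x \<le> y")
    case True
    then show ?thesis using that finite_pcoeff_le by (intro Min_le) auto
  next
    case False
    then show ?thesis using in_A by auto
  qed
  then show ?thesis using in_A that by blast
qed

lemma pcoeff_lower_bound: obtains m where "\<And>x. pcoeff f x \<noteq> 0 \<Longrightarrow> m \<le> x"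
proof (cases "\<exists>y. pcoeff f y \<noteq> 0")
  case True
  then obtain y where "pcoeff f y \<noteq> 0" ..
  then show ?thesis by (rule pcoeff_least) (rule that)
next
  case False
  then show ?thesis using that by blast
qed

lemma finite_pcoeff_shift_le: "finite {x. pcoeff f (x - a) \<noteq> 0 \<and> x \<le> b}"
proof -
  have "{x. pcoeff f (x - a) \<noteq> 0 \<and> x \<le> b} \<subseteq> (\<lambda>y. y + a) ` {y. pcoeff f y \<noteq> 0 \<and> y \<le> b - a}"
    by (auto intro!: image_eqI[where x = "_ - a"])
  then show ?thesis by (rule finite_subset) (simp add: finite_pcoeff_le)
qed

definition tpow :: "real \<Rightarrow> puiseux" where
  "tpow \<mu> = Abs_puiseux (\<lambda>x. if x = \<mu> then 1 else 0)"

lemma pcoeff_tpow: "pcoeff (tpow \<mu>) x = (if x = \<mu> then 1 else 0)"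
  unfolding tpow_def by (subst pcoeff_Abs) (auto intro: finite_subset[of _ "{\<mu>}"])

text \<open>The Cauchy product; the index set is finite for every \<open>x\<close>.\<close>

definition conv_index :: "puiseux \<Rightarrow> puiseux \<Rightarrow> real \<Rightarrow> real set" where
  "conv_index f g x = {a. pcoeff f a \<noteq> 0 \<and> pcoeff g (x - a) \<noteq> 0}"

instantiation puiseux :: "{zero, one, plus, minus, uminus, times}"
begin

definition "0 = Abs_puiseux (\<lambda>_. 0)"
definition "1 = tpow 0"
definition "f + g = Abs_puiseux (\<lambda>x. pcoeff f x + pcoeff g x)"
definition "- f = Abs_puiseux (\<lambda>x. - pcoeff f x)"
definition "f - g = Abs_puiseux (\<lambda>x. pcoeff f x - pcoeff g x)" for f g :: puiseux
definition "f * g = Abs_puiseux (\<lambda>x. \<Sum>a\<in>conv_index f g x. pcoeff f a * pcoeff g (x - a))"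

instance ..

end

lemma pcoeff_0 [simp]: "pcoeff 0 x = 0"
  by (simp add: zero_puiseux_def pcoeff_Abs)

lemma pcoeff_1: "pcoeff 1 x = (if x = 0 then 1 else 0)"
  by (simp add: one_puiseux_def pcoeff_tpow)

lemma pcoeff_add [simp]: "pcoeff (f + g) x = pcoeff f x + pcoeff g x"
  unfolding plus_puiseux_def
  by (subst pcoeff_Abs)
     (auto intro: finite_subset[OF _ finite_UnI[OF finite_pcoeff_le[of f] finite_pcoeff_le[of g]]])

lemma pcoeff_diff [simp]: "pcoeff (f - g) x = pcoeff f x - pcoeff g x"
  unfolding minus_puiseux_def
  by (subst pcoeff_Abs)
     (auto intro: finite_subset[OF _ finite_UnI[OF finite_pcoeff_le[of f] finite_pcoeff_le[of g]]])

lemma pcoeff_uminus [simp]: "pcoeff (- f) x = - pcoeff f x"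
  unfolding uminus_puiseux_def by (subst pcoeff_Abs) (simp_all add: finite_pcoeff_le)

lemma finite_conv_index: "finite (conv_index f g x)"
proof -
  obtain m where m: "\<And>y. pcoeff g y \<noteq> 0 \<Longrightarrow> m \<le> y" by (rule pcoeff_lower_bound[of g]) blast
  have "conv_index f g x \<subseteq> {a. pcoeff f a \<noteq> 0 \<and> a \<le> x - m}"
    using m by (force simp: conv_index_def)
  then show ?thesis by (rule finite_subset) (rule finite_pcoeff_le)
qed

lemma pcoeff_mult: "pcoeff (f * g) x = (\<Sum>a\<in>conv_index f g x. pcoeff f a * pcoeff g (x - a))"
proof -
  let ?F = "\<lambda>x. \<Sum>a\<in>conv_index f g x. pcoeff f a * pcoeff g (x - a)"
  have "finite {x. ?F x \<noteq> 0 \<and> x \<le> b}" for b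
  proof -
    obtain m where m: "\<And>y. pcoeff f y \<noteq> 0 \<Longrightarrow> m \<le> y" by (rule pcoeff_lower_bound[of f]) blast
    obtain k where k: "\<And>y. pcoeff g y \<noteq> 0 \<Longrightarrow> k \<le> y" by (rule pcoeff_lower_bound[of g]) blast
    let ?A = "{a. pcoeff f a \<noteq> 0 \<and> a \<le> b - k}"
    have "{x. ?F x \<noteq> 0 \<and> x \<le> b} \<subseteq> (\<Union>a\<in>?A. {x. pcoeff g (x - a) \<noteq> 0 \<and> x \<le> b})"
    proof
      fix x assume x: "x \<in> {x. ?F x \<noteq> 0 \<and> x \<le> b}"
      then have "conv_index f g x \<noteq> {}" by auto
      then obtain a where a: "pcoeff f a \<noteq> 0" "pcoeff g (x - a) \<noteq> 0"
        by (auto simp: conv_index_def)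
      then have "a \<le> b - k" using k[of "x - a"] x by auto
      then show "x \<in> (\<Union>a\<in>?A. {x. pcoeff g (x - a) \<noteq> 0 \<and> x \<le> b})" using a x by auto
    qed
    then show ?thesis
      by (rule finite_subset) (intro finite_UN_I finite_pcoeff_le finite_pcoeff_shift_le)
  qed
  then have "pcoeff (Abs_puiseux ?F) = ?F" by (rule pcoeff_Abs)
  then show ?thesis by (simp add: times_puiseux_def)
qed

lemma pcoeff_mult_superset:
  assumes "finite A" "conv_index f g x \<subseteq> A"
  shows "pcoeff (f * g) x = (\<Sum>a\<in>A. pcoeff f a * pcoeff g (x - a))"
  unfolding pcoeff_mult
  by (rule sum.mono_neutral_left) (use assms in \<open>auto simp: conv_index_def\<close>)

lemma puiseux_mult_commute: "f * g = g * (f :: puiseux)"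
proof (rule puiseux_eqI)
  fix x
  show "pcoeff (f * g) x = pcoeff (g * f) x"
    unfolding pcoeff_mult
    by (rule sum.reindex_bij_witness[of _ "\<lambda>a. x - a" "\<lambda>a. x - a"])
       (auto simp: conv_index_def)
qed

lemma pcoeff_mult_superset':
  assumes "finite A" "\<And>a. pcoeff f a \<noteq> 0 \<Longrightarrow> pcoeff g (x - a) \<noteq> 0 \<Longrightarrow> x - a \<in> A"
  shows "pcoeff (f * g) x = (\<Sum>a\<in>A. pcoeff f (x - a) * pcoeff g a)"
proof -
  have "conv_index g f x \<subseteq> A"
    using assms(2)[of "x - _"] by (auto simp: conv_index_def)
  then show ?thesis
    using pcoeff_mult_superset[of A g f x] assms(1)
    by (simp add: puiseux_mult_commute[of f g] mult.commute)
qed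

instance puiseux :: comm_ring_1
proof
  fix f g h :: puiseux
  show "f + g + h = f + (g + h)" by (rule puiseux_eqI) simp
  show "f + g = g + f" by (rule puiseux_eqI) simp
  show "0 + f = f" by (rule puiseux_eqI) simp
  show "- f + f = 0" by (rule puiseux_eqI) simp
  show "f - g = f + - g" by (rule puiseux_eqI) simp
  show "f * g = g * f" by (rule puiseux_mult_commute)
  show "(0::puiseux) \<noteq> 1"
  proof
    assume "(0::puiseux) = 1"
    then have "pcoeff 0 0 = pcoeff 1 0" by simp
    then show False by (simp add: pcoeff_1)
  qed
  show "1 * f = f"
  proof (rule puiseux_eqI)
    fix x
    have "pcoeff (1 * f) x = (\<Sum>a\<in>{0}. pcoeff 1 a * pcoeff f (x - a))"
      by (rule pcoeff_mult_superset) (auto simp: conv_index_def pcoeff_1 split: if_splits)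
    then show "pcoeff (1 * f) x = pcoeff f x" by (simp add: pcoeff_1)
  qed
  show "(f + g) * h = f * h + g * h"
  proof (rule puiseux_eqI)
    fix x
    let ?A = "conv_index f h x \<union> conv_index g h x"
    have fin: "finite ?A" by (simp add: finite_conv_index)
    have "pcoeff ((f + g) * h) x = (\<Sum>a\<in>?A. pcoeff (f + g) a * pcoeff h (x - a))"
      by (rule pcoeff_mult_superset[OF fin]) (auto simp: conv_index_def)
    also have "\<dots> = pcoeff (f * h) x + pcoeff (g * h) x"
      by (simp add: pcoeff_mult_superset[OF fin] distrib_right sum.distrib)
    finally show "pcoeff ((f + g) * h) x = pcoeff (f * h + g * h) x" by simp
  qed
  show "f * g * h = f * (g * h)"
  proof (rule puiseux_eqI)
    fix x
    obtain l where l: "\<And>y. pcoeff f y \<noteq> 0 \<Longrightarrow> l \<le> y" by (rule pcoeff_lower_bound[of f]) blast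
    obtain m where m: "\<And>y. pcoeff g y \<noteq> 0 \<Longrightarrow> m \<le> y" by (rule pcoeff_lower_bound[of g]) blast
    obtain k where k: "\<And>y. pcoeff h y \<noteq> 0 \<Longrightarrow> k \<le> y" by (rule pcoeff_lower_bound[of h]) blast
    have lm: "l + m \<le> y" if "pcoeff (f * g) y \<noteq> 0" for y
    proof -
      have "conv_index f g y \<noteq> {}" using that by (auto simp: pcoeff_mult)
      then obtain a where "pcoeff f a \<noteq> 0" "pcoeff g (y - a) \<noteq> 0" by (auto simp: conv_index_def)
      then show ?thesis using l[of a] m[of "y - a"] by linarith
    qed
    have mk: "m + k \<le> y" if "pcoeff (g * h) y \<noteq> 0" for y
    proof -
      have "conv_index g h y \<noteq> {}" using that by (auto simp: pcoeff_mult)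
      then obtain a where "pcoeff g a \<noteq> 0" "pcoeff h (y - a) \<noteq> 0" by (auto simp: conv_index_def)
      then show ?thesis using m[of a] k[of "y - a"] by linarith
    qed
    let ?A = "{a. pcoeff f a \<noteq> 0 \<and> a \<le> x - m - k}"
    let ?C = "{c. pcoeff h c \<noteq> 0 \<and> c \<le> x - l - m}"
    have finA: "finite ?A" and finC: "finite ?C" by (rule finite_pcoeff_le)+
    have "pcoeff (f * g * h) x = (\<Sum>c\<in>?C. pcoeff (f * g) (x - c) * pcoeff h c)"
      by (rule pcoeff_mult_superset'[OF finC]) (use lm in force)
    also have "\<dots> = (\<Sum>c\<in>?C. (\<Sum>a\<in>?A. pcoeff f a * pcoeff g (x - c - a)) * pcoeff h c)"
    proof (rule sum.cong[OF refl])
      fix c assume c: "c \<in> ?C"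
      then have "k \<le> c" using k by auto
      have "conv_index f g (x - c) \<subseteq> ?A"
      proof
        fix a assume "a \<in> conv_index f g (x - c)"
        then have "pcoeff f a \<noteq> 0" "m \<le> x - c - a" using m by (auto simp: conv_index_def)
        then show "a \<in> ?A" using \<open>k \<le> c\<close> by auto
      qed
      from pcoeff_mult_superset[OF finA this]
      show "pcoeff (f * g) (x - c) * pcoeff h c =
          (\<Sum>a\<in>?A. pcoeff f a * pcoeff g (x - c - a)) * pcoeff h c" by simp
    qed
    also have "\<dots> = (\<Sum>c\<in>?C. \<Sum>a\<in>?A. pcoeff f a * pcoeff g (x - c - a) * pcoeff h c)"
      by (simp add: sum_distrib_right)
    also have "\<dots> = (\<Sum>a\<in>?A. \<Sum>c\<in>?C. pcoeff f a * pcoeff g (x - c - a) * pcoeff h c)"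
      by (rule sum.swap)
    also have "\<dots> = (\<Sum>a\<in>?A. pcoeff f a * (\<Sum>c\<in>?C. pcoeff g (x - a - c) * pcoeff h c))"
      by (simp add: sum_distrib_left mult.assoc algebra_simps)
    also have "\<dots> = (\<Sum>a\<in>?A. pcoeff f a * pcoeff (g * h) (x - a))"
    proof (rule sum.cong[OF refl])
      fix a assume a: "a \<in> ?A"
      then have "l \<le> a" using l by auto
      have "pcoeff (g * h) (x - a) = (\<Sum>c\<in>?C. pcoeff g (x - a - c) * pcoeff h c)"
      proof (rule pcoeff_mult_superset'[OF finC])
        fix b assume "pcoeff g b \<noteq> 0" "pcoeff h (x - a - b) \<noteq> 0"
        then show "x - a - b \<in> ?C" using m[of b] \<open>l \<le> a\<close> by auto
      qed
      then show "pcoeff f a * (\<Sum>c\<in>?C. pcoeff g (x - a - c) * pcoeff h c) =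
          pcoeff f a * pcoeff (g * h) (x - a)" by simp
    qed
    also have "\<dots> = pcoeff (f * (g * h)) x"
      by (rule pcoeff_mult_superset[OF finA, symmetric]) (use mk in \<open>force simp: conv_index_def\<close>)
    finally show "pcoeff (f * g * h) x = pcoeff (f * (g * h)) x" .
  qed
qed

lemma pcoeff_mult_lower:
  assumes "\<And>y. pcoeff f y \<noteq> 0 \<Longrightarrow> l \<le> y" "\<And>y. pcoeff g y \<noteq> 0 \<Longrightarrow> m \<le> y" "pcoeff (f * g) x \<noteq> 0"
  shows "l + m \<le> x"
proof -
  have "conv_index f g x \<noteq> {}" using assms(3) by (auto simp: pcoeff_mult)
  then obtain a where "pcoeff f a \<noteq> 0" "pcoeff g (x - a) \<noteq> 0" by (auto simp: conv_index_def)
  then show ?thesis using assms(1)[of a] assms(2)[of "x - a"] by linarith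
qed

lemma pcoeff_power_lower:
  assumes "\<And>y. pcoeff f y \<noteq> 0 \<Longrightarrow> e \<le> y"
  shows "pcoeff (f ^ n) x \<noteq> 0 \<Longrightarrow> real n * e \<le> x"
proof (induction n arbitrary: x)
  case 0
  then show ?case by (simp add: pcoeff_1 split: if_splits)
next
  case (Suc n)
  have "e + real n * e \<le> x"
    by (rule pcoeff_mult_lower[of f e "f ^ n"]) (use assms Suc in auto)
  then show ?case by (simp add: algebra_simps)
qed

lemma pcoeff_sum_puiseux: "pcoeff (\<Sum>i\<in>A. F i) x = (\<Sum>i\<in>A. pcoeff (F i) x)"
  by (induction A rule: infinite_finite_induct) auto

text \<open>Geometric series: \<open>1 - g\<close> is invertible if all exponents of \<open>g\<close> are positive.\<close>

lemma puiseux_geometric: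
  assumes g: "\<And>y. pcoeff g y \<noteq> 0 \<Longrightarrow> 0 < y"
  shows "\<exists>h. (1 - g) * h = 1"
proof -
  obtain e where e: "0 < e" "\<And>y. pcoeff g y \<noteq> 0 \<Longrightarrow> e \<le> y"
  proof (cases "\<exists>y. pcoeff g y \<noteq> 0")
    case True
    then obtain m where "pcoeff g m \<noteq> 0" "\<And>x. pcoeff g x \<noteq> 0 \<Longrightarrow> m \<le> x"
      using pcoeff_least by blast
    then show ?thesis using that[of m] g by blast
  qed (use that[of 1] in auto)
  define N where "N x = nat (\<lceil>x / e\<rceil>) + 1" for x
  have big: "x < real n * e" if "N x \<le> n" for x n
  proof -
    have "x / e < real (N x)" unfolding N_def by linarith
    also have "\<dots> \<le> real n" using that by simp
    finally show ?thesis using e(1) by (simp add: field_simps)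
  qed
  have zero: "pcoeff (g ^ n) x = 0" if "N x \<le> n" for x n
    using pcoeff_power_lower[of g e n x] e(2) big[OF that] by force
  define H where "H n = (\<Sum>i<n. g ^ i)" for n
  have H_stable: "pcoeff (H n) x = pcoeff (H (N x)) x" if "N x \<le> n" for x n
    unfolding H_def pcoeff_sum_puiseux
    by (rule sum.mono_neutral_right) (use that zero in auto)
  have N_mono: "N x \<le> N y" if "x \<le> y" for x y
  proof -
    have "x / e \<le> y / e" using that e(1) by (simp add: divide_right_mono)
    then have "nat \<lceil>x / e\<rceil> \<le> nat \<lceil>y / e\<rceil>" by (intro nat_mono ceiling_mono)
    then show ?thesis unfolding N_def by simp
  qed
  define h where "h = Abs_puiseux (\<lambda>x. pcoeff (H (N x)) x)"
  have "finite {x. pcoeff (H (N x)) x \<noteq> 0 \<and> x \<le> b}" for b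
  proof -
    have "{x. pcoeff (H (N x)) x \<noteq> 0 \<and> x \<le> b} \<subseteq> {x. pcoeff (H (N b)) x \<noteq> 0 \<and> x \<le> b}"
    proof
      fix x assume x: "x \<in> {x. pcoeff (H (N x)) x \<noteq> 0 \<and> x \<le> b}"
      then have "pcoeff (H (N b)) x = pcoeff (H (N x)) x" by (intro H_stable N_mono) simp
      with x show "x \<in> {x. pcoeff (H (N b)) x \<noteq> 0 \<and> x \<le> b}" by simp
    qed
    then show ?thesis by (rule finite_subset) (rule finite_pcoeff_le)
  qed
  then have h: "pcoeff h = (\<lambda>x. pcoeff (H (N x)) x)"
    unfolding h_def by (rule pcoeff_Abs)
  have "(1 - g) * h = 1"
  proof (rule puiseux_eqI)
    fix x
    have nonneg: "0 \<le> a" if "pcoeff (1 - g) a \<noteq> 0" for a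
      using that g[of a] by (auto simp: pcoeff_1 split: if_splits)
    have same: "pcoeff h y = pcoeff (H (N x)) y" if "y \<le> x" for y
      using H_stable[OF N_mono[OF that]] by (simp add: h)
    have eq: "conv_index (1 - g) h x = conv_index (1 - g) (H (N x)) x"
    proof -
      have "pcoeff h (x - a) = pcoeff (H (N x)) (x - a)" if "pcoeff (1 - g) a \<noteq> 0" for a
        using nonneg[OF that] by (intro same) simp
      then show ?thesis unfolding conv_index_def by metis
    qed
    have "pcoeff ((1 - g) * h) x = pcoeff ((1 - g) * H (N x)) x"
      unfolding pcoeff_mult eq
    proof (rule sum.cong[OF refl])
      fix a assume "a \<in> conv_index (1 - g) (H (N x)) x"
      then have "0 \<le> a" using nonneg unfolding conv_index_def by blast
      then show "pcoeff (1 - g) a * pcoeff h (x - a) = pcoeff (1 - g) a * pcoeff (H (N x)) (x - a)"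
        by (simp add: same)
    qed
    also have "(1 - g) * H (N x) = 1 - g ^ N x"
      unfolding H_def by (rule one_diff_power_eq[symmetric])
    also have "pcoeff \<dots> x = pcoeff 1 x" by (simp add: zero)
    finally show "pcoeff ((1 - g) * h) x = pcoeff 1 x" .
  qed
  then show ?thesis ..
qed

lemma pcoeff_monomial_mult:
  assumes "\<And>x. x \<noteq> \<mu> \<Longrightarrow> pcoeff q x = 0"
  shows "pcoeff (q * f) x = pcoeff q \<mu> * pcoeff f (x - \<mu>)"
proof -
  have "pcoeff (q * f) x = (\<Sum>a\<in>{\<mu>}. pcoeff q a * pcoeff f (x - a))"
    by (rule pcoeff_mult_superset) (use assms in \<open>auto simp: conv_index_def\<close>)
  then show ?thesis by simp
qed

lemma puiseux_inverse_exists: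
  assumes "f \<noteq> (0 :: puiseux)"
  shows "\<exists>h. f * h = 1"
proof -
  obtain y where "pcoeff f y \<noteq> 0" using assms puiseux_eqI[of f 0] by auto
  then obtain m where m: "pcoeff f m \<noteq> 0" "\<And>x. pcoeff f x \<noteq> 0 \<Longrightarrow> m \<le> x"
    using pcoeff_least by blast
  define q where "q = Abs_puiseux (\<lambda>x. if x = - m then inverse (pcoeff f m) else 0)"
  have q: "pcoeff q x = (if x = - m then inverse (pcoeff f m) else 0)" for x
    unfolding q_def by (subst pcoeff_Abs) (auto intro: finite_subset[of _ "{- m}"])
  have qf: "pcoeff (q * f) x = inverse (pcoeff f m) * pcoeff f (x + m)" for x
    by (subst pcoeff_monomial_mult[of "- m"]) (simp_all add: q)
  have "0 < y" if "pcoeff (1 - q * f) y \<noteq> 0" for y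
  proof -
    have "y \<noteq> 0" using that m(1) by (auto simp: qf pcoeff_1)
    then have "pcoeff f (y + m) \<noteq> 0" using that by (auto simp: qf pcoeff_1)
    then have "0 \<le> y" using m(2)[of "y + m"] by simp
    then show ?thesis using \<open>y \<noteq> 0\<close> by simp
  qed
  then obtain h where "(1 - (1 - q * f)) * h = 1" using puiseux_geometric by blast
  then have "f * (q * h) = 1" by (simp add: mult_ac)
  then show ?thesis ..
qed

instantiation puiseux :: field
begin

definition "inverse f = (if f = 0 then 0 else (SOME h. f * h = 1))" for f :: puiseux
definition "f div g = f * inverse g" for f g :: puiseux

instance
proof
  fix f g :: puiseux
  show "inverse f * f = 1" if "f \<noteq> 0"
    using someI_ex[OF puiseux_inverse_exists[OF that]] that
    by (simp add: inverse_puiseux_def mult.commute)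
  show "f div g = f * inverse g" by (rule divide_puiseux_def)
  show "inverse (0 :: puiseux) = 0" by (simp add: inverse_puiseux_def)
qed

end

text \<open>Only meaningful for nonzero arguments (\<open>Val 0\<close> would be \<open>\<infinity>\<close>).\<close>

definition val :: "puiseux \<Rightarrow> real" where
  "val f = (LEAST \<mu>. pcoeff f \<mu> \<noteq> 0)"

lemma
  assumes "f \<noteq> 0"
  shows pcoeff_val_nonzero: "pcoeff f (val f) \<noteq> 0"
    and val_le: "pcoeff f x \<noteq> 0 \<Longrightarrow> val f \<le> x"
proof -
  obtain y where "pcoeff f y \<noteq> 0" using assms puiseux_eqI[of f 0] by auto
  then obtain m where m: "pcoeff f m \<noteq> 0" "\<And>x. pcoeff f x \<noteq> 0 \<Longrightarrow> m \<le> x"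
    using pcoeff_least by blast
  then have "val f = m" unfolding val_def by (intro Least_equality)
  then show "pcoeff f (val f) \<noteq> 0" "pcoeff f x \<noteq> 0 \<Longrightarrow> val f \<le> x" using m by auto
qed

definition puiseux_pos :: "puiseux set" where
  "puiseux_pos = {f. f \<noteq> 0 \<and> (\<exists>a::real. 0 < a \<and> pcoeff f (val f) = complex_of_real a)}"


section \<open>The torus and tropical critical points\<close>

text \<open>
  After the choice of a basis of \<open>M\<close> and the dual basis of \<open>N\<close>, both lattices are
  \<^typ>\<open>int ^ 'r\<close> and \<open>M\<^sub>\<real>\<close>, \<open>N\<^sub>\<real>\<close> are \<^typ>\<open>real ^ 'r\<close>.  The pairing is used both on
  \<open>M \<times> N\<close> and on \<open>M \<times> N\<^sub>\<real>\<close>.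
\<close>

definition pairing :: "int ^ 'r \<Rightarrow> ('a :: comm_ring_1) ^ 'r \<Rightarrow> 'a" where
  "pairing v u = (\<Sum>j\<in>UNIV. of_int (v $ j) * u $ j)"

definition torus :: "(int ^ 'r \<Rightarrow> puiseux) set" where
  "torus = {p. (\<forall>v. p v \<noteq> 0) \<and> (\<forall>v w. p (v + w) = p v * p w)}"

definition torus_pos :: "(int ^ 'r \<Rightarrow> puiseux) set" where
  "torus_pos = {p \<in> torus. \<forall>v. p v \<in> puiseux_pos}"

definition val_torus :: "(int ^ 'r \<Rightarrow> puiseux) \<Rightarrow> real ^ 'r" where
  "val_torus p = (THE d. \<forall>v. val (p v) = pairing v d)"

text \<open>Laurent polynomials over \<open>K\<close> with exponents in \<open>M\<close> are finitely supported functions.\<close>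

definition superpotential ::
    "nat \<Rightarrow> (nat \<Rightarrow> int ^ 'r) \<Rightarrow> (nat \<Rightarrow> real) \<Rightarrow> (int ^ 'r) \<Rightarrow>\<^sub>0 puiseux" where
  "superpotential n v c = (\<Sum>i\<in>{1..n}. Poly_Mapping.single (v i) (tpow (c i)))"

text \<open>All logarithmic derivatives \<open>\<partial>\<^sub>u x\<^sup>v = \<langle>v, u\<rangle> x\<^sup>v\<close> vanish at \<open>p\<close>.\<close>

definition critical_point :: "((int ^ 'r) \<Rightarrow>\<^sub>0 puiseux) \<Rightarrow> (int ^ 'r \<Rightarrow> puiseux) \<Rightarrow> bool" where
  "critical_point W p \<longleftrightarrow>
     (\<forall>u :: int ^ 'r. (\<Sum>v\<in>Poly_Mapping.keys W.
        Poly_Mapping.lookup W v * of_int (pairing v u) * p v) = 0)"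

lemma critical_point_superpotential:
  "critical_point (superpotential n v c) p \<longleftrightarrow>
     (\<forall>u. (\<Sum>i\<in>{1..n}. tpow (c i) * of_int (pairing (v i) u) * p (v i)) = 0)"
proof -
  let ?W = "superpotential n v c"
  have "(\<Sum>w\<in>Poly_Mapping.keys ?W. Poly_Mapping.lookup ?W w * of_int (pairing w u) * p w) =
      (\<Sum>i\<in>{1..n}. tpow (c i) * of_int (pairing (v i) u) * p (v i))" for u
  proof -
    let ?V = "v ` {1..n}"
    let ?m = "\<lambda>w. of_int (pairing w u) * p w"
    have lookup: "Poly_Mapping.lookup ?W w = (\<Sum>i\<in>{1..n}. if v i = w then tpow (c i) else 0)" for w
      by (simp add: superpotential_def lookup_sum lookup_single when_def)
    have "Poly_Mapping.keys ?W \<subseteq> ?V"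
    proof
      fix w assume "w \<in> Poly_Mapping.keys ?W"
      then have "(\<Sum>i\<in>{1..n}. if v i = w then tpow (c i) else 0) \<noteq> 0"
        unfolding in_keys_iff lookup .
      then show "w \<in> ?V"
        by (rule sum.not_neutral_contains_not_neutral) (auto split: if_splits)
    qed
    then have "(\<Sum>w\<in>Poly_Mapping.keys ?W. Poly_Mapping.lookup ?W w * of_int (pairing w u) * p w) =
        (\<Sum>w\<in>?V. Poly_Mapping.lookup ?W w * ?m w)"
      by (intro sum.mono_neutral_cong_left) (auto simp: in_keys_iff mult.assoc)
    also have "\<dots> = (\<Sum>w\<in>?V. \<Sum>i\<in>{1..n}. if v i = w then tpow (c i) * ?m w else 0)"
      unfolding lookup sum_distrib_right by (intro sum.cong refl) simp
    also have "\<dots> = (\<Sum>i\<in>{1..n}. \<Sum>w\<in>?V. if v i = w then tpow (c i) * ?m w else 0)"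
      by (rule sum.swap)
    also have "\<dots> = (\<Sum>i\<in>{1..n}. tpow (c i) * ?m (v i))"
    proof (rule sum.cong[OF refl])
      fix i assume "i \<in> {1..n}"
      then have "v i \<in> ?V" by (rule imageI)
      then show "(\<Sum>w\<in>?V. if v i = w then tpow (c i) * ?m w else 0) = tpow (c i) * ?m (v i)"
        by (simp only: sum.delta' finite_imageI finite_atLeastAtMost if_True)
    qed
    finally show ?thesis by (simp add: mult.assoc)
  qed
  then show ?thesis by (simp add: critical_point_def)
qed

definition p_crit :: "((int ^ 'r) \<Rightarrow>\<^sub>0 puiseux) \<Rightarrow> (int ^ 'r \<Rightarrow> puiseux)" where
  "p_crit W = (THE p. p \<in> torus_pos \<and> critical_point W p)"

definition d_crit :: "((int ^ 'r) \<Rightarrow>\<^sub>0 puiseux) \<Rightarrow> real ^ 'r" where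
  "d_crit W = val_torus (p_crit W)"


section \<open>Delzant polytopes\<close>

definition lattice_basis :: "('r \<Rightarrow> int ^ 'r) \<Rightarrow> bool" where
  "lattice_basis b \<longleftrightarrow> (\<forall>w. \<exists>!a :: 'r \<Rightarrow> int. w = (\<Sum>j\<in>UNIV. a j *s b j))"

definition real_vec :: "int ^ 'r \<Rightarrow> real ^ 'r" where
  "real_vec u = (\<chi> j. real_of_int (u $ j))"

definition delzant :: "(real ^ 'r) set \<Rightarrow> bool" where
  "delzant P \<longleftrightarrow> polytope P \<and> aff_dim P = int CARD('r) \<and>
     (\<forall>x. x extreme_point_of P \<longrightarrow>
        card {E. E edge_of P \<and> x \<in> E} = CARD('r) \<and>
        (\<exists>(b :: 'r \<Rightarrow> int ^ 'r) \<phi>. lattice_basis b \<and> bij_betw \<phi> UNIV {E. E edge_of P \<and> x \<in> E} \<and>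
           (\<forall>j. \<phi> j \<subseteq> {x + s *\<^sub>R real_vec (b j) | s. 0 \<le> s})))"

definition primitive :: "int ^ 'r \<Rightarrow> bool" where
  "primitive v \<longleftrightarrow> v \<noteq> 0 \<and> (\<forall>(k :: int) w. v = k *s w \<longrightarrow> \<bar>k\<bar> = 1)"

definition ell :: "(nat \<Rightarrow> int ^ 'r) \<Rightarrow> (nat \<Rightarrow> real) \<Rightarrow> nat \<Rightarrow> real ^ 'r \<Rightarrow> real" where
  "ell v c i d = pairing (v i) d + c i"

definition facet_presentation ::
    "nat \<Rightarrow> (nat \<Rightarrow> int ^ 'r) \<Rightarrow> (nat \<Rightarrow> real) \<Rightarrow> (real ^ 'r) set \<Rightarrow> bool" where
  "facet_presentation n v c P \<longleftrightarrow>
     P = (\<Inter>i\<in>{1..n}. {d. 0 \<le> ell v c i d}) \<and>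
     bij_betw (\<lambda>i. {d \<in> P. ell v c i d = 0}) {1..n} {F. F facet_of P} \<and>
     (\<forall>i\<in>{1..n}. primitive (v i))"


section \<open>The point of Fukaya, Oh, Ohta and Ono\<close>

text \<open>
  In the following three definitions \<open>Q\<close> is the polytope \<open>P\<^sub>k\<close> and \<open>J\<close> is
  \<open>I\<^sub>0 \<union> \<dots> \<union> I\<^sub>k\<close>.
\<close>

definition fooo_s ::
    "nat \<Rightarrow> (nat \<Rightarrow> int ^ 'r) \<Rightarrow> (nat \<Rightarrow> real) \<Rightarrow> nat set \<Rightarrow> real ^ 'r \<Rightarrow> real" where
  "fooo_s n v c J d = Min ((\<lambda>i. ell v c i d) ` ({1..n} - J))"

definition fooo_S ::
    "nat \<Rightarrow> (nat \<Rightarrow> int ^ 'r) \<Rightarrow> (nat \<Rightarrow> real) \<Rightarrow> (real ^ 'r) set \<Rightarrow> nat set \<Rightarrow> real" where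
  "fooo_S n v c Q J = (SUP d\<in>rel_interior Q. fooo_s n v c J d)"

definition fooo_next ::
    "nat \<Rightarrow> (nat \<Rightarrow> int ^ 'r) \<Rightarrow> (nat \<Rightarrow> real) \<Rightarrow> (real ^ 'r) set \<times> nat set \<Rightarrow>
       (real ^ 'r) set \<times> nat set" where
  "fooo_next n v c = (\<lambda>(Q, J).
     let S = fooo_S n v c Q J;
         Q' = {d \<in> rel_interior Q. fooo_s n v c J d = S};
         I = {i \<in> {1..n} - J. \<forall>d\<in>Q'. ell v c i d = S}
     in (Q', J \<union> I))"

text \<open>The pair \<open>(P\<^sub>k, I\<^sub>0 \<union> \<dots> \<union> I\<^sub>k)\<close>, constant from the first \<open>k\<close> on at which
  \<open>P\<^sub>k\<close> is a single point.\<close>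

primrec fooo_stage ::
    "nat \<Rightarrow> (nat \<Rightarrow> int ^ 'r) \<Rightarrow> (nat \<Rightarrow> real) \<Rightarrow> (real ^ 'r) set \<Rightarrow> nat \<Rightarrow>
       (real ^ 'r) set \<times> nat set" where
  "fooo_stage n v c P 0 = (P, {})"
| "fooo_stage n v c P (Suc k) =
     (if is_singleton (fst (fooo_stage n v c P k)) then fooo_stage n v c P k
      else fooo_next n v c (fooo_stage n v c P k))"

definition fooo_point ::
    "nat \<Rightarrow> (nat \<Rightarrow> int ^ 'r) \<Rightarrow> (nat \<Rightarrow> real) \<Rightarrow> (real ^ 'r) set \<Rightarrow> real ^ 'r" where
  "fooo_point n v c P = (THE u. \<exists>K. fst (fooo_stage n v c P K) = {u})"

end

(* A point d of N_R is called balanced if for every u <> 0, among the indices i with <v_i,u> <> 0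
   and l_i(d) minimal, both signs of <v_i,u> occur.  The point u_0 is balanced: on each P_k the
   constancy of the l_i with i in I_k forces both signs to occur among the <v_i,u>, i in I_k.

   A balanced d lifts to a critical point.  The leading coefficient e^b is a limit point, as k
   tends to infinity, of the minimisers of the convex functions sum_i exp(<v_i,x> - k l_i(d));
   balancedness keeps these bounded.  The corrections 1 + h are found by a Newton iteration
   whose linear part is the Gram matrix sum_i a_i v_i v_i^T, a_i = e^<v_i,b> t^(l_i(d)).  Solving
   least squares problems with these weights never lowers orders in t, however unequal the l_i are.

   Positive critical points are unique by a similar convexity argument, so p_crit is the
   lift just constructed. *)

theory Submission
  imports Defs
begin

section \<open>Leading coefficients from convex minimisation\<close>

text \<open>The function sum_i exp(<v_i,x> - k l_i(d)) is W evaluated at t = e^(-k) and at the point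
  t^d e^x, so its minimisers are genuine real positive critical points, and b is a limit of them as
  t tends to 0. The obstacle is that the levels l_i(d) differ in general. What survives for b is one
  vanishing sum for each direction u, over the lowest level among the i with <v_i,u> nonzero. The
  limit over k yields these sums for all levels at once, without a basis adapted to the flag of
  levels. The same sums return in the Newton step: they remove the cross terms in the lowest degree
  and leave squares with positive weights. This is why orders do not drop and why the first
  correction has positive order.\<close>

text \<open>The convex function \<open>f\<close> dominates the positively homogeneous
  \<open>g\<close>, which is positive on the unit sphere and hence at least
  \<open>m * norm x\<close>. So \<open>f\<close> is proper and has a minimum, and the claimed
  equations say that its gradient vanishes there.\<close>

lemma exp_sum_critical_point:
  fixes a :: "'i \<Rightarrow> 'a::euclidean_space" and w :: "'i \<Rightarrow> real"
  assumes fin: "finite I" and w: "\<And>i. i \<in> I \<Longrightarrow> 0 < w i"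
    and span: "\<And>u. u \<noteq> 0 \<Longrightarrow> \<exists>i\<in>I. 0 < a i \<bullet> u"
  shows "\<exists>x. \<forall>u. (\<Sum>i\<in>I. (a i \<bullet> u) * (w i * exp (a i \<bullet> x))) = 0"
proof -
  define f where "f x = (\<Sum>i\<in>I. w i * exp (a i \<bullet> x))" for x
  define g where "g x = (\<Sum>i\<in>I. w i * max 0 (a i \<bullet> x))" for x
  have cont_f: "continuous_on A f" for A
    unfolding f_def by (intro continuous_intros)
  have cont_g: "continuous_on A g" for A
    unfolding g_def by (intro continuous_intros)
  have g_pos: "0 < g x" if x: "x \<noteq> 0" for x
  proof -
    obtain i where i: "i \<in> I" "0 < a i \<bullet> x" using span[OF x] by blast
    have "0 < w i * max 0 (a i \<bullet> x)" using w i by (simp add: max_def)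
    also have "\<dots> \<le> g x" unfolding g_def
      by (rule member_le_sum[OF i(1) _ fin]) (use w in \<open>simp add: less_imp_le\<close>)
    finally show ?thesis .
  qed
  have g_scale: "g (k *\<^sub>R x) = k * g x" if "0 \<le> k" for k x
  proof -
    have "max 0 (k * r) = k * max 0 r" for r :: real
      using that by (simp add: max_mult_distrib_left)
    then show ?thesis by (simp add: g_def sum_distrib_left mult.left_commute)
  qed
  have "\<exists>m>0. \<forall>x. m * norm x \<le> g x"
  proof -
    have "sphere (0::'a) 1 \<noteq> {}" by simp
    then obtain y where y: "y \<in> sphere 0 1" "\<And>x. x \<in> sphere 0 1 \<Longrightarrow> g y \<le> g x"
      using continuous_attains_inf[OF compact_sphere _ cont_g] by blast
    have "g y * norm x \<le> g x" for x
    proof (cases "x = 0")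
      case True then show ?thesis by (simp add: g_def)
    next
      case False
      have "g y \<le> g ((1 / norm x) *\<^sub>R x)" using False by (intro y(2)) simp
      also have "\<dots> = g x / norm x" by (simp add: g_scale)
      finally show ?thesis using False by (simp add: field_simps)
    qed
    moreover have "0 < g y" using y(1) by (intro g_pos) auto
    ultimately show ?thesis by blast
  qed
  then obtain m where m: "0 < m" "\<And>x. m * norm x \<le> g x" by blast
  have g_le_f: "g x \<le> f x" for x
    unfolding f_def g_def
  proof (intro sum_mono mult_left_mono)
    fix i assume "i \<in> I"
    then show "0 \<le> w i" using w by (simp add: less_imp_le)
    show "max 0 (a i \<bullet> x) \<le> exp (a i \<bullet> x)"
      using exp_ge_add_one_self[of "a i \<bullet> x"] exp_ge_zero[of "a i \<bullet> x"] by linarith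
  qed
  let ?B = "cball (0::'a) (f 0 / m)"
  have "0 \<le> f 0" unfolding f_def using w by (intro sum_nonneg) (simp add: less_imp_le)
  then have "0 \<in> ?B" using m by simp
  then obtain x where x: "x \<in> ?B" "\<And>y. y \<in> ?B \<Longrightarrow> f x \<le> f y"
    using continuous_attains_inf[OF compact_cball _ cont_f] by blast
  have min: "f x \<le> f y" for y
  proof (cases "y \<in> ?B")
    case False
    then have "f 0 / m < norm y" by simp
    then have "f 0 < m * norm y" using m by (simp add: field_simps)
    also have "\<dots> \<le> f y" using m(2) g_le_f order_trans by blast
    finally show ?thesis using x(2)[OF \<open>0 \<in> ?B\<close>] by simp
  qed (rule x(2))
  have "(\<Sum>i\<in>I. (a i \<bullet> u) * (w i * exp (a i \<bullet> x))) = 0" for u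
  proof -
    have "((\<lambda>s. f (x + s *\<^sub>R u)) has_real_derivative
        (\<Sum>i\<in>I. w i * (exp (a i \<bullet> (x + 0 *\<^sub>R u)) * (a i \<bullet> u)))) (at 0)"
      unfolding f_def by (intro DERIV_sum) (auto intro!: derivative_eq_intros simp: inner_add_right)
    then have "(\<Sum>i\<in>I. w i * (exp (a i \<bullet> (x + 0 *\<^sub>R u)) * (a i \<bullet> u))) = 0"
      by (rule DERIV_local_min[where d = 1]) (simp_all add: min)
    then show ?thesis by (simp add: mult_ac)
  qed
  then show ?thesis by blast
qed

text \<open>For each k there is a critical point \<open>x k\<close> for the weights e^(-k l_i). If
  these were unbounded, with limiting direction t, the balanced index for t would give a positive
  term that blows up, while the terms of negative sign, whose levels are no lower, stay bounded. So
  a subsequence converges to \<xi>. At level \<delta>, higher levels vanish in the limit and lower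
  ones do not see u.\<close>

lemma graded_exp_sum_critical_point:
  fixes a :: "'i \<Rightarrow> 'a::euclidean_space" and l :: "'i \<Rightarrow> real"
  assumes fin: "finite I"
    and bal: "\<And>u. u \<noteq> 0 \<Longrightarrow> \<exists>i\<in>I. 0 < a i \<bullet> u \<and> (\<forall>j\<in>I. a j \<bullet> u \<noteq> 0 \<longrightarrow> l i \<le> l j)"
  shows "\<exists>\<xi>. \<forall>u \<delta>. (\<forall>i\<in>I. a i \<bullet> u \<noteq> 0 \<longrightarrow> \<delta> \<le> l i) \<longrightarrow>
    (\<Sum>i\<in>{i\<in>I. l i = \<delta>}. (a i \<bullet> u) * exp (a i \<bullet> \<xi>)) = 0"
proof -
  have "\<exists>x. \<forall>u. (\<Sum>i\<in>I. (a i \<bullet> u) * (exp (- real k * l i) * exp (a i \<bullet> x))) = 0" for k :: nat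
    by (rule exp_sum_critical_point[OF fin]) (use bal in auto)
  then obtain x where x: "\<And>k u. (\<Sum>i\<in>I. (a i \<bullet> u) * (exp (- real k * l i) * exp (a i \<bullet> x k))) = 0"
    by metis
  \<comment> \<open>The factor e^(k \<delta>) gives the terms of level \<delta> weight one and those
    of higher level a weight tending to 0.\<close>
  have shift: "(\<Sum>i\<in>I. (a i \<bullet> u) * exp (a i \<bullet> x k - real k * (l i - \<delta>))) = 0" for u k \<delta>
  proof -
    have "(\<Sum>i\<in>I. (a i \<bullet> u) * exp (a i \<bullet> x k - real k * (l i - \<delta>))) =
      exp (real k * \<delta>) * (\<Sum>i\<in>I. (a i \<bullet> u) * (exp (- real k * l i) * exp (a i \<bullet> x k)))"
      unfolding sum_distrib_left
      by (intro sum.cong refl) (simp add: exp_diff exp_minus algebra_simps field_simps flip: exp_add)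
    then show ?thesis using x by simp
  qed
  have "bounded (range x)"
  proof (rule ccontr)
    assume "\<not> bounded (range x)"
    then have "\<exists>k. real m + 1 < norm (x k)" for m
      unfolding bounded_iff by (metis not_le rangeE)
    \<comment> \<open>The bound \<open>real m + 1\<close> makes every norm positive, so that the
      points can be normalised, and forces the norms to infinity along every subsequence.\<close>
    then obtain \<kappa> where \<kappa>: "\<And>m. real m + 1 < norm (x (\<kappa> m))" by metis
    define \<theta> where "\<theta> m = (1 / norm (x (\<kappa> m))) *\<^sub>R x (\<kappa> m)" for m
    have nz: "0 < norm (x (\<kappa> m))" for m using \<kappa>[of m] by linarith
    then have "\<theta> m \<in> sphere 0 1" for m by (simp add: \<theta>_def)
    then obtain t \<sigma> where t: "t \<in> sphere 0 1" "strict_mono (\<sigma> :: nat \<Rightarrow> nat)"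
      "(\<theta> \<circ> \<sigma>) \<longlonglongrightarrow> t"
      using compact_sphere[of "0::'a" 1] unfolding compact_def by metis
    define y where "y m = x (\<kappa> (\<sigma> m))" for m
    have y: "y m = norm (y m) *\<^sub>R (\<theta> \<circ> \<sigma>) m" for m
      using nz[of "\<sigma> m"] by (simp add: y_def \<theta>_def)
    have norm_y: "filterlim (\<lambda>m. norm (y m)) at_top sequentially"
    proof (rule filterlim_at_top_mono[OF filterlim_real_sequentially])
      have "real m \<le> norm (y m)" for m
        using \<kappa>[of "\<sigma> m"] seq_suble[OF t(2), of m] by (simp add: y_def)
      then show "eventually (\<lambda>m. real m \<le> norm (y m)) sequentially" by simp
    qed
    have lim: "(\<lambda>m. a i \<bullet> (\<theta> \<circ> \<sigma>) m) \<longlonglongrightarrow> a i \<bullet> t" for i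
      by (intro tendsto_intros t(3))
    have ay: "a i \<bullet> y m = (a i \<bullet> (\<theta> \<circ> \<sigma>) m) * norm (y m)" for i m
      using y[of m] by (metis inner_scaleR_right mult.commute)
    have neg: "eventually (\<lambda>m. a i \<bullet> y m \<le> 0) sequentially" if "a i \<bullet> t < 0" for i
      using order_tendstoD(2)[OF lim that]
      by eventually_elim (unfold ay, intro mult_nonpos_nonneg, auto)
    have pos: "filterlim (\<lambda>m. a i \<bullet> y m) at_top sequentially" if "0 < a i \<bullet> t" for i
      unfolding ay by (rule filterlim_tendsto_pos_mult_at_top[OF lim that norm_y])
    have "t \<noteq> 0" using t(1) by auto
    then obtain i where i: "i \<in> I" "0 < a i \<bullet> t" "\<And>j. j \<in> I \<Longrightarrow> a j \<bullet> t \<noteq> 0 \<Longrightarrow> l i \<le> l j"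
      using bal by blast
    \<comment> \<open>\<open>C\<close> bounds all negative contributions together. Since e^s > s,
      the threshold \<open>C / (a i \<bullet> t)\<close> already makes the term of \<open>i\<close>
      exceed \<open>C\<close>, so the sum normalised at level \<open>l i\<close> cannot
      vanish.\<close>
    define C where "C = (\<Sum>j\<in>I. \<bar>a j \<bullet> t\<bar>)"
    have "eventually (\<lambda>m. C / (a i \<bullet> t) \<le> a i \<bullet> y m) sequentially"
      using pos[OF i(2)] by (simp add: filterlim_at_top)
    moreover have "eventually (\<lambda>m. \<forall>j\<in>I. a j \<bullet> t < 0 \<longrightarrow> a j \<bullet> y m \<le> 0) sequentially"
      using neg by (intro eventually_ball_finite fin) auto
    ultimately have "eventually (\<lambda>m. False) sequentially"
    proof eventually_elim
      case (elim m)
      let ?k = "\<kappa> (\<sigma> m)"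
      let ?e = "\<lambda>j. (a j \<bullet> t) * exp (a j \<bullet> y m - real ?k * (l j - l i))"
      have "- \<bar>a j \<bullet> t\<bar> \<le> ?e j" if "j \<in> I" for j
      proof (cases "a j \<bullet> t < 0")
        case True
        then have "l i \<le> l j" using i(3) that by auto
        then have "a j \<bullet> y m - real ?k * (l j - l i) \<le> 0"
          using elim(2) True that by (meson diff_ge_0_iff_ge mult_nonneg_nonneg of_nat_0_le_iff
            diff_le_0_iff_le order_trans)
        then have "exp (a j \<bullet> y m - real ?k * (l j - l i)) \<le> 1" by simp
        then have "(a j \<bullet> t) * 1 \<le> ?e j" using True by (intro mult_left_mono_neg) auto
        then show ?thesis using True by simp
      next
        case False
        then have "0 \<le> ?e j" by simp
        then show ?thesis by linarith
      qed
      then have rest: "- (\<Sum>j\<in>I - {i}. \<bar>a j \<bullet> t\<bar>) \<le> (\<Sum>j\<in>I - {i}. ?e j)"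
        unfolding sum_negf[symmetric] by (intro sum_mono) auto
      have "C \<le> (a i \<bullet> t) * (a i \<bullet> y m)" using elim(1) i(2) by (simp add: field_simps)
      also have "\<dots> < ?e i"
        using i(2) less_le_trans[OF _ exp_ge_add_one_self[of "a i \<bullet> y m"]] by simp
      finally have "C < ?e i" .
      moreover have "C = \<bar>a i \<bullet> t\<bar> + (\<Sum>j\<in>I - {i}. \<bar>a j \<bullet> t\<bar>)"
        unfolding C_def by (rule sum.remove[OF fin i(1)])
      moreover have "(\<Sum>j\<in>I. ?e j) = ?e i + (\<Sum>j\<in>I - {i}. ?e j)"
        by (rule sum.remove[OF fin i(1)])
      moreover have "(\<Sum>j\<in>I. ?e j) = 0" unfolding y_def by (rule shift)
      ultimately show False using rest i(2) by linarith
    qed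
    then show False by simp
  qed
  then obtain \<xi> \<sigma> where \<xi>: "strict_mono (\<sigma> :: nat \<Rightarrow> nat)" "(x \<circ> \<sigma>) \<longlonglongrightarrow> \<xi>"
    using bounded_imp_convergent_subsequence by blast
  have "(\<Sum>i\<in>{i\<in>I. l i = \<delta>}. (a i \<bullet> u) * exp (a i \<bullet> \<xi>)) = 0"
    if low: "\<forall>i\<in>I. a i \<bullet> u \<noteq> 0 \<longrightarrow> \<delta> \<le> l i" for u \<delta>
  proof -
    let ?e = "\<lambda>i k. (a i \<bullet> u) * exp (a i \<bullet> x k - real k * (l i - \<delta>))"
    let ?L = "\<lambda>i. if l i = \<delta> then (a i \<bullet> u) * exp (a i \<bullet> \<xi>) else 0"
    have conv: "(\<lambda>m. a i \<bullet> (x \<circ> \<sigma>) m) \<longlonglongrightarrow> a i \<bullet> \<xi>" for i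
      by (intro tendsto_intros \<xi>(2))
    have "(\<lambda>m. ?e i (\<sigma> m)) \<longlonglongrightarrow> ?L i" if "i \<in> I" for i
    proof -
      consider "a i \<bullet> u = 0" | "l i = \<delta>" | "\<delta> < l i" using low \<open>i \<in> I\<close> by fastforce
      then show ?thesis
      proof cases
        case 2
        then show ?thesis using conv[of i] by (auto intro!: tendsto_intros simp: o_def)
      next
        case 3
        have "filterlim (\<lambda>m. real (\<sigma> m)) at_top sequentially"
          using filterlim_compose[OF filterlim_real_sequentially filterlim_subseq[OF \<xi>(1)]] .
        then have "filterlim (\<lambda>m. (l i - \<delta>) * real (\<sigma> m)) at_top sequentially"
          using 3 by (intro filterlim_tendsto_pos_mult_at_top[OF tendsto_const]) auto
        then have "filterlim (\<lambda>m. - ((l i - \<delta>) * real (\<sigma> m))) at_bot sequentially"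
          by (simp add: filterlim_uminus_at_top)
        then have "filterlim (\<lambda>m. a i \<bullet> (x \<circ> \<sigma>) m + - ((l i - \<delta>) * real (\<sigma> m))) at_bot sequentially"
          by (rule filterlim_tendsto_add_at_bot_iff[OF conv[of i], THEN iffD2])
        then have "((\<lambda>m. exp (a i \<bullet> (x \<circ> \<sigma>) m + - ((l i - \<delta>) * real (\<sigma> m)))) \<longlonglongrightarrow> 0)"
          by (rule filterlim_compose[OF exp_at_bot])
        then have "(\<lambda>m. (a i \<bullet> u) * exp (a i \<bullet> (x \<circ> \<sigma>) m + - ((l i - \<delta>) * real (\<sigma> m)))) \<longlonglongrightarrow> (a i \<bullet> u) * 0"
          by (intro tendsto_intros)
        then show ?thesis using 3 by (simp add: mult.commute o_def)
      qed simp
    qed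
    then have "(\<lambda>m. \<Sum>i\<in>I. ?e i (\<sigma> m)) \<longlonglongrightarrow> (\<Sum>i\<in>I. ?L i)" by (rule tendsto_sum)
    then have "(\<Sum>i\<in>I. ?L i) = 0" unfolding shift by (simp add: LIMSEQ_const_iff)
    then show ?thesis using fin by (simp add: sum.inter_filter)
  qed
  then show ?thesis by blast
qed

section \<open>The point of Fukaya, Oh, Ohta and Ono is balanced\<close>

text \<open>Only the positive sign is asked for: the condition for -u supplies the negative sign at
  the same minimal level.\<close>

definition balanced ::
    "nat \<Rightarrow> (nat \<Rightarrow> int ^ 'r) \<Rightarrow> (nat \<Rightarrow> real) \<Rightarrow> real ^ 'r \<Rightarrow> bool" where
  "balanced n v c d \<longleftrightarrow> (\<forall>u :: real ^ 'r. u \<noteq> 0 \<longrightarrow> (\<exists>i\<in>{1..n}. 0 < pairing (v i) u \<and>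
     (\<forall>j\<in>{1..n}. pairing (v j) u \<noteq> 0 \<longrightarrow> ell v c i d \<le> ell v c j d)))"

lemma pairing_inner: "pairing v (u :: real ^ 'r) = real_vec v \<bullet> u"
  by (simp add: pairing_def real_vec_def inner_vec_def)

lemma ell_add_scaleR: "ell v c i (x + s *\<^sub>R u) = ell v c i x + s * pairing (v i) u"
  by (simp add: ell_def pairing_inner inner_add_right)

lemma ell_segment:
  "ell v c i ((1 - s) *\<^sub>R x + s *\<^sub>R y) = (1 - s) * ell v c i x + s * ell v c i y"
  by (simp add: ell_def pairing_inner inner_add_right algebra_simps)

lemma continuous_on_ell: "continuous_on A (ell v c i)"
  unfolding ell_def pairing_inner by (intro continuous_intros)

lemma continuous_on_fooo_s:
  assumes "{1..n} - J \<noteq> {}"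
  shows "continuous_on A (fooo_s n v c J)"
proof -
  have "continuous_on A (\<lambda>d. Min ((\<lambda>i. ell v c i d) ` K))" if "finite K" "K \<noteq> {}" for K
    using that
  proof (induction K rule: finite_ne_induct)
    case (insert i K)
    then show ?case
      by (simp add: continuous_on_min continuous_on_ell)
  qed (simp add: continuous_on_ell)
  then show ?thesis using assms unfolding fooo_s_def by (metis finite_Diff finite_atLeastAtMost)
qed

lemma le_fooo_s_iff:
  assumes "{1..n} - J \<noteq> {}"
  shows "S \<le> fooo_s n v c J d \<longleftrightarrow> (\<forall>i\<in>{1..n} - J. S \<le> ell v c i d)"
  using assms by (simp add: fooo_s_def)

lemma less_fooo_s_iff:
  assumes "{1..n} - J \<noteq> {}"
  shows "S < fooo_s n v c J d \<longleftrightarrow> (\<forall>i\<in>{1..n} - J. S < ell v c i d)"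
  using assms by (simp add: fooo_s_def)

text \<open>An affine function that is at least S at two points and exceeds S at one of them exceeds
  S at their midpoint; the indices are treated one after the other.\<close>

lemma convex_common_strict_point:
  assumes "finite K" "convex Q" "Q \<noteq> {}"
    and ge: "\<And>i d. i \<in> K \<Longrightarrow> d \<in> Q \<Longrightarrow> S \<le> ell v c i d"
    and gt: "\<And>i. i \<in> K \<Longrightarrow> \<exists>d\<in>Q. S < ell v c i d"
  shows "\<exists>d\<in>Q. \<forall>i\<in>K. S < ell v c i d"
  using assms(1) ge gt
proof (induction K rule: finite_induct)
  case empty
  then show ?case using assms(3) by auto
next
  case (insert k K)
  then obtain x where x: "x \<in> Q" "\<forall>i\<in>K. S < ell v c i x" by auto
  obtain y where y: "y \<in> Q" "S < ell v c k y" using insert.prems(2) by auto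
  let ?z = "(1 - 1/2) *\<^sub>R x + (1/2) *\<^sub>R y"
  have z: "?z \<in> Q" using assms(2) x(1) y(1) by (intro convexD) auto
  have "S < ell v c i ?z" if "i \<in> insert k K" for i
  proof -
    have "S \<le> ell v c i x" "S \<le> ell v c i y" "S < ell v c i x \<or> S < ell v c i y"
      using that x y insert.prems(1) by auto
    then show ?thesis unfolding ell_segment by (auto simp: field_simps)
  qed
  then show ?case using z by blast
qed

text \<open>For \<open>(Q, J)\<close> = \<open>(P\<^sub>k, I\<^sub>0 \<union> \<dots> \<union> I\<^sub>k)\<close>, the level \<open>S\<close> is \<open>S\<^sub>k\<close> (and \<open>0\<close> for \<open>k = 0\<close>), and \<open>\<gamma> i\<close>
  is \<open>S\<^sub>j\<close> for \<open>i \<in> I\<^sub>j\<close>.\<close>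

definition fooo_invariant ::
    "nat \<Rightarrow> (nat \<Rightarrow> int ^ 'r) \<Rightarrow> (nat \<Rightarrow> real) \<Rightarrow> (nat \<Rightarrow> real) \<Rightarrow> real \<Rightarrow>
       (real ^ 'r) set \<Rightarrow> nat set \<Rightarrow> bool" where
  "fooo_invariant n v c \<gamma> S Q J \<longleftrightarrow> compact Q \<and> J \<subseteq> {1..n} \<and>
     Q = {d. (\<forall>i\<in>J. ell v c i d = \<gamma> i) \<and> (\<forall>i\<in>{1..n} - J. S \<le> ell v c i d)} \<and>
     (\<forall>i\<in>J. \<gamma> i \<le> S) \<and> (\<exists>d\<in>Q. \<forall>i\<in>{1..n} - J. S < ell v c i d) \<and>
     (\<forall>u :: real ^ 'r. (\<exists>i\<in>J. pairing (v i) u \<noteq> 0) \<longrightarrow>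
        (\<exists>i\<in>J. 0 < pairing (v i) u \<and> (\<forall>j\<in>J. pairing (v j) u \<noteq> 0 \<longrightarrow> \<gamma> i \<le> \<gamma> j)))"

context
  fixes n :: nat and v :: "nat \<Rightarrow> int ^ 'r" and c \<gamma> :: "nat \<Rightarrow> real" and S :: real
    and Q :: "(real ^ 'r) set" and J :: "nat set"
  assumes inv: "fooo_invariant n v c \<gamma> S Q J"
begin

private lemma compact_Q: "compact Q" and J: "J \<subseteq> {1..n}"
  and Q_iff: "d \<in> Q \<longleftrightarrow> (\<forall>i\<in>J. ell v c i d = \<gamma> i) \<and> (\<forall>i\<in>{1..n} - J. S \<le> ell v c i d)"
  and \<gamma>_le: "i \<in> J \<Longrightarrow> \<gamma> i \<le> S"
  and strict_point: "\<exists>d\<in>Q. \<forall>i\<in>{1..n} - J. S < ell v c i d"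
  and balanced_J: "\<exists>i\<in>J. pairing (v i) (u :: real ^ 'r) \<noteq> 0 \<Longrightarrow>
    \<exists>i\<in>J. 0 < pairing (v i) u \<and> (\<forall>j\<in>J. pairing (v j) u \<noteq> 0 \<longrightarrow> \<gamma> i \<le> \<gamma> j)"
  using inv unfolding fooo_invariant_def by blast+

private lemma convex_Q: "convex Q"
proof (rule convexI)
  fix x y :: "real ^ 'r" and a b :: real
  assume xy: "x \<in> Q" "y \<in> Q" and ab: "0 \<le> a" "0 \<le> b" "a + b = 1"
  have a: "a = 1 - b" using ab(3) by simp
  have "ell v c i (a *\<^sub>R x + b *\<^sub>R y) = \<gamma> i" if "i \<in> J" for i
    using xy that unfolding a ell_segment Q_iff by (simp add: algebra_simps)
  moreover have "S \<le> ell v c i (a *\<^sub>R x + b *\<^sub>R y)" if "i \<in> {1..n} - J" for i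
  proof -
    have "a * S + b * S \<le> a * ell v c i x + b * ell v c i y"
      using xy that ab unfolding Q_iff by (intro add_mono mult_left_mono) auto
    then show ?thesis unfolding a ell_segment by (simp add: algebra_simps)
  qed
  ultimately show "a *\<^sub>R x + b *\<^sub>R y \<in> Q" unfolding Q_iff by blast
qed

text \<open>A segment from a strict point to d extends a little beyond d inside \<open>Q\<close>, so
  no affine constraint can be tight at d. Conversely, near a strict point only the equations for
  \<open>J\<close> matter, and they hold on the affine hull.\<close>

private lemma rel_interior_Q:
  "d \<in> rel_interior Q \<longleftrightarrow> d \<in> Q \<and> (\<forall>i\<in>{1..n} - J. S < ell v c i d)"
proof
  assume d: "d \<in> rel_interior Q"
  then have dQ: "d \<in> Q" using rel_interior_subset by blast
  obtain x where x: "x \<in> Q" "\<forall>i\<in>{1..n} - J. S < ell v c i x" using strict_point by blast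
  obtain e where e: "1 < e" "(1 - e) *\<^sub>R x + e *\<^sub>R d \<in> Q"
    using d x(1) convex_rel_interior_iff[OF convex_Q] by blast
  have "S < ell v c i d" if i: "i \<in> {1..n} - J" for i
  proof -
    have "S \<le> (1 - e) * ell v c i x + e * ell v c i d"
      using e(2) i unfolding Q_iff ell_segment by blast
    moreover have "(e - 1) * S < (e - 1) * ell v c i x"
      using x(2) i e(1) by (intro mult_strict_left_mono) auto
    ultimately have "e * S < e * ell v c i d" by (simp add: algebra_simps)
    then show ?thesis using e(1) by simp
  qed
  then show "d \<in> Q \<and> (\<forall>i\<in>{1..n} - J. S < ell v c i d)" using dQ by blast
next
  assume d: "d \<in> Q \<and> (\<forall>i\<in>{1..n} - J. S < ell v c i d)"
  let ?L = "{d. \<forall>i\<in>J. ell v c i d = \<gamma> i}"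
  let ?T = "\<Inter>i\<in>{1..n} - J. {d. S < ell v c i d}"
  have "affine ?L"
    unfolding affine_alt mem_Collect_eq ell_segment by (simp add: left_diff_distrib)
  then have "affine hull Q \<subseteq> ?L" by (intro hull_minimal) (auto simp: Q_iff)
  then have "?T \<inter> affine hull Q \<subseteq> Q" by (auto simp: Q_iff less_imp_le)
  moreover have "open ?T"
    by (intro open_INT ballI open_Collect_less continuous_on_const continuous_on_ell) auto
  moreover have "d \<in> ?T" using d by blast
  ultimately show "d \<in> rel_interior Q" using d mem_rel_interior[of d Q] by blast
qed

private lemma small_step:
  assumes x: "x \<in> Q" and K: "\<And>i. i \<in> K \<Longrightarrow> S' < ell v c i x" "K \<subseteq> {1..n}"
  shows "\<exists>s>0. \<forall>i\<in>K. S' < ell v c i (x + s *\<^sub>R u)"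
proof -
  have fin: "finite K" using K(2) finite_subset by blast
  have "((\<lambda>s. ell v c i (x + s *\<^sub>R u)) \<longlongrightarrow> ell v c i x) (at_right 0)" for i
    unfolding ell_add_scaleR by (auto intro!: tendsto_eq_intros)
  then have "eventually (\<lambda>s. S' < ell v c i (x + s *\<^sub>R u)) (at_right 0)" if "i \<in> K" for i
    using order_tendstoD(1) K(1)[OF that] by blast
  then have "eventually (\<lambda>s. \<forall>i\<in>K. S' < ell v c i (x + s *\<^sub>R u)) (at_right 0)"
    by (intro eventually_ball_finite fin) auto
  moreover have "eventually (\<lambda>s::real. 0 < s) (at_right 0)"
    by (simp add: eventually_at_filter)
  ultimately have "eventually (\<lambda>s. 0 < s \<and> (\<forall>i\<in>K. S' < ell v c i (x + s *\<^sub>R u))) (at_right 0)"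
    by eventually_elim simp
  then show ?thesis using eventually_happens trivial_limit_at_right_real by blast
qed

text \<open>A nonzero u orthogonal to all v_i with i in \<open>J\<close> would allow a small move
  inside \<open>Q\<close>, so some i in \<open>J\<close> sees u. The minimal level is then attained
  in \<open>J\<close>, because the remaining indices have levels above S.\<close>

lemma fooo_invariant_singleton:
  assumes "Q = {d}"
  shows "balanced n v c d"
  unfolding balanced_def
proof (intro allI impI)
  fix u :: "real ^ 'r" assume u: "u \<noteq> 0"
  have strict: "S < ell v c i d" if "i \<in> {1..n} - J" for i using strict_point that assms by blast
  have d: "ell v c i d = \<gamma> i" if "i \<in> J" for i using Q_iff[of d] assms that by blast
  have "\<exists>i\<in>J. pairing (v i) u \<noteq> 0"
  proof (rule ccontr)
    assume orth: "\<not> ?thesis"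
    obtain s where s: "0 < s" "\<forall>i\<in>{1..n} - J. S < ell v c i (d + s *\<^sub>R u)"
      using small_step[of d "{1..n} - J" S u] strict assms by blast
    then have "d + s *\<^sub>R u \<in> Q"
      unfolding Q_iff using d orth by (auto simp: ell_add_scaleR less_imp_le)
    then show False using assms u s(1) by simp
  qed
  then obtain i where i: "i \<in> J" "0 < pairing (v i) u"
      "\<forall>j\<in>J. pairing (v j) u \<noteq> 0 \<longrightarrow> \<gamma> i \<le> \<gamma> j"
    using balanced_J by blast
  have "ell v c i d \<le> ell v c j d" if "j \<in> {1..n}" "pairing (v j) u \<noteq> 0" for j
  proof (cases "j \<in> J")
    case True then show ?thesis using i d that by simp
  next
    case False then show ?thesis using strict[of j] d[OF i(1)] \<gamma>_le[OF i(1)] that by simp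
  qed
  then show "\<exists>i\<in>{1..n}. 0 < pairing (v i) u \<and>
      (\<forall>j\<in>{1..n}. pairing (v j) u \<noteq> 0 \<longrightarrow> ell v c i d \<le> ell v c j d)"
    using i J by blast
qed

text \<open>The equations for all i determine a point, since the v_i span. Hence the construction
  stops before the minimum in \<open>fooo_s\<close> would range over the empty set.\<close>

lemma fooo_invariant_full:
  assumes span: "\<And>u :: real ^ 'r. u \<noteq> 0 \<Longrightarrow> \<exists>i\<in>{1..n}. 0 < pairing (v i) u" and "J = {1..n}"
  shows "is_singleton Q"
proof -
  obtain x where x: "x \<in> Q" using strict_point by blast
  have "y = x" if y: "y \<in> Q" for y
  proof (rule ccontr)
    assume "y \<noteq> x"
    then obtain i where i: "i \<in> {1..n}" "0 < pairing (v i) (y - x)" using span[of "y - x"] by auto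
    have "ell v c i y = ell v c i x" using x y i(1) assms(2) unfolding Q_iff by simp
    then show False using i(2) by (simp add: ell_def pairing_inner inner_diff_right)
  qed
  then have "Q = {x}" using x by blast
  then show ?thesis by simp
qed

text \<open>The new level lies strictly above the old one, so directions seen by \<open>J\<close>
  keep their minimal level. For the other directions, the constancy of the new functions on
  \<open>Q'\<close> produces both signs.\<close>

lemma fooo_invariant_next:
  assumes ne: "{1..n} - J \<noteq> {}" and nxt: "fooo_next n v c (Q, J) = (Q', J')"
  shows "J \<subset> J' \<and> (\<exists>\<gamma>' S'. fooo_invariant n v c \<gamma>' S' Q' J')"
proof -
  let ?s = "fooo_s n v c J"
  \<comment> \<open>A maximiser over the compact \<open>Q\<close> has a value of \<open>?s\<close>
    above S, because \<open>p\<close> has one. It therefore lies in the relative interior, and the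
    supremum defining \<open>fooo_S\<close> is a maximum.\<close>
  obtain p where p: "p \<in> Q" "S < ?s p" using strict_point by (auto simp: less_fooo_s_iff[OF ne])
  obtain m where m: "m \<in> Q" "\<And>d. d \<in> Q \<Longrightarrow> ?s d \<le> ?s m"
    using continuous_attains_sup[OF compact_Q _ continuous_on_fooo_s[OF ne]] p by blast
  define S' where "S' = ?s m"
  have S': "S < S'" using p m unfolding S'_def by (meson less_le_trans)
  have ri: "d \<in> rel_interior Q \<longleftrightarrow> d \<in> Q \<and> S < ?s d" for d
    unfolding rel_interior_Q less_fooo_s_iff[OF ne] ..
  have mri: "m \<in> rel_interior Q" using m S' by (simp add: ri S'_def)
  have "fooo_S n v c Q J = S'"
    unfolding fooo_S_def S'_def by (rule cSup_eq_maximum) (use mri m ri in auto)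
  then have Q': "Q' = {d \<in> rel_interior Q. ?s d = S'}"
    and J'_eq: "J' = J \<union> {i \<in> {1..n} - J. \<forall>d\<in>Q'. ell v c i d = S'}"
    using nxt by (auto simp: fooo_next_def Let_def)
  define I where "I = {i \<in> {1..n} - J. \<forall>d\<in>Q'. ell v c i d = S'}"
  have J': "J' = J \<union> I" unfolding I_def by (rule J'_eq)
  have I_sub: "I \<subseteq> {1..n} - J" unfolding I_def by blast
  have Q'_S: "d \<in> Q' \<longleftrightarrow> d \<in> Q \<and> S' \<le> ?s d" for d
    unfolding Q' using S' m by (auto simp: ri S'_def intro: antisym)
  have mQ': "m \<in> Q'" using m by (simp add: Q'_S S'_def)
  have I_val: "ell v c i d = S'" if "i \<in> I" "d \<in> Q'" for i d using that unfolding I_def by blast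
  have Q'_ge: "S' \<le> ell v c i d" if "d \<in> Q'" "i \<in> {1..n} - J" for i d
    using that Q'_S le_fooo_s_iff[OF ne] by blast
  define \<gamma>' where "\<gamma>' i = (if i \<in> J then \<gamma> i else S')" for i
  have Q'_iff: "d \<in> Q' \<longleftrightarrow> (\<forall>i\<in>J'. ell v c i d = \<gamma>' i) \<and> (\<forall>i\<in>{1..n} - J'. S' \<le> ell v c i d)" for d
  proof
    assume d: "d \<in> Q'"
    then have "\<forall>i\<in>J. ell v c i d = \<gamma> i" using Q'_S Q_iff by blast
    then show "(\<forall>i\<in>J'. ell v c i d = \<gamma>' i) \<and> (\<forall>i\<in>{1..n} - J'. S' \<le> ell v c i d)"
      using Q'_ge[OF d] I_val[OF _ d] I_sub by (auto simp: J' \<gamma>'_def)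
  next
    assume d: "(\<forall>i\<in>J'. ell v c i d = \<gamma>' i) \<and> (\<forall>i\<in>{1..n} - J'. S' \<le> ell v c i d)"
    have "S' \<le> ell v c i d" if "i \<in> {1..n} - J" for i
      using d that by (cases "i \<in> J'") (auto simp: \<gamma>'_def)
    moreover have "ell v c i d = \<gamma> i" if "i \<in> J" for i using d that by (auto simp: \<gamma>'_def J')
    ultimately show "d \<in> Q'"
      unfolding Q'_S Q_iff le_fooo_s_iff[OF ne] using S' by (meson less_imp_le order_trans)
  qed
  have "convex Q'"
  proof (rule convexI)
    fix x y :: "real ^ 'r" and a b :: real
    assume xy: "x \<in> Q'" "y \<in> Q'" and ab: "0 \<le> a" "0 \<le> b" "a + b = 1"
    have a: "a = 1 - b" using ab(3) by simp
    have "S' \<le> ell v c i (a *\<^sub>R x + b *\<^sub>R y)" if "i \<in> {1..n} - J" for i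
    proof -
      have "a * S' + b * S' \<le> a * ell v c i x + b * ell v c i y"
        using xy that ab Q'_ge by (intro add_mono mult_left_mono) auto
      then show ?thesis unfolding a ell_segment by (simp add: algebra_simps)
    qed
    moreover have "a *\<^sub>R x + b *\<^sub>R y \<in> Q" using xy ab convex_Q by (intro convexD) (auto simp: Q'_S)
    ultimately show "a *\<^sub>R x + b *\<^sub>R y \<in> Q'" unfolding Q'_S le_fooo_s_iff[OF ne] by blast
  qed
  have "\<exists>d\<in>Q'. \<forall>i\<in>{1..n} - J'. S' < ell v c i d"
  proof (rule convex_common_strict_point)
    show "S' \<le> ell v c i d" if "i \<in> {1..n} - J'" "d \<in> Q'" for i d using that Q'_iff by blast
    show "\<exists>d\<in>Q'. S' < ell v c i d" if "i \<in> {1..n} - J'" for i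
    proof -
      have "i \<in> {1..n} - J" "i \<notin> I" using that by (auto simp: J')
      then obtain d where "d \<in> Q'" "ell v c i d \<noteq> S'" unfolding I_def by blast
      then show ?thesis using Q'_ge[OF \<open>d \<in> Q'\<close> \<open>i \<in> {1..n} - J\<close>] by (intro bexI[of _ d]) auto
    qed
  qed (use \<open>convex Q'\<close> mQ' in auto)
  then obtain x where x: "x \<in> Q'" "\<And>i. i \<in> {1..n} - J' \<Longrightarrow> S' < ell v c i x" by blast
  \<comment> \<open>Without a new index, the minimum over the remaining functions at x would exceed
    its own maximum S'.\<close>
  have "J \<noteq> J'"
  proof
    assume "J = J'"
    then have "S' < ?s x" using x(2) unfolding less_fooo_s_iff[OF ne] by blast
    then show False using m(2)[of x] x(1) by (simp add: S'_def Q'_S)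
  qed
  then have sub: "J \<subset> J'" by (auto simp: J')
  have bal: "\<exists>i\<in>J'. 0 < pairing (v i) u \<and> (\<forall>j\<in>J'. pairing (v j) u \<noteq> 0 \<longrightarrow> \<gamma>' i \<le> \<gamma>' j)"
    if ex: "\<exists>i\<in>J'. pairing (v i) u \<noteq> 0" for u :: "real ^ 'r"
  proof (cases "\<exists>i\<in>J. pairing (v i) u \<noteq> 0")
    case True
    then obtain i where i: "i \<in> J" "0 < pairing (v i) u"
      "\<forall>j\<in>J. pairing (v j) u \<noteq> 0 \<longrightarrow> \<gamma> i \<le> \<gamma> j" using balanced_J by blast
    have "\<gamma>' i \<le> \<gamma>' j" if "j \<in> J'" "pairing (v j) u \<noteq> 0" for j
      using i that \<gamma>_le[OF i(1)] S' by (auto simp: \<gamma>'_def)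
    then show ?thesis using i sub by blast
  next
    case False
    \<comment> \<open>Otherwise a small move from x along -u lowers no function in \<open>I\<close>,
      keeps those in \<open>J\<close> fixed and stays in \<open>Q'\<close>, yet raises the function
      of \<open>k\<close>, which is constant on \<open>Q'\<close>.\<close>
    have "\<exists>i\<in>I. 0 < pairing (v i) u"
    proof (rule ccontr)
      assume no: "\<not> ?thesis"
      obtain k where k: "k \<in> I" "pairing (v k) u \<noteq> 0" using ex False by (auto simp: J')
      obtain s where s: "0 < s" "\<forall>i\<in>{1..n} - J'. S' < ell v c i (x + s *\<^sub>R (- u))"
        using small_step[of x "{1..n} - J'" S' "- u"] x Q'_S by blast
      have neg: "pairing (v i) (- u) = - pairing (v i) u" for i by (simp add: pairing_inner)
      have "S' \<le> ell v c i (x + s *\<^sub>R (- u))" if "i \<in> {1..n} - J" for i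
      proof (cases "i \<in> I")
        case True
        have "0 \<le> s * - pairing (v i) u"
          using no s(1) True by (intro mult_nonneg_nonneg) (auto simp: not_less)
        then show ?thesis using I_val[OF True x(1)] unfolding ell_add_scaleR neg by simp
      next
        case False
        then show ?thesis using s(2) that by (auto simp: J' less_imp_le)
      qed
      moreover have "ell v c i (x + s *\<^sub>R (- u)) = \<gamma> i" if "i \<in> J" for i
        using that False x(1) Q'_S[of x] Q_iff[of x] unfolding ell_add_scaleR neg by auto
      ultimately have "x + s *\<^sub>R (- u) \<in> Q'"
        unfolding Q'_S Q_iff le_fooo_s_iff[OF ne] using S' by (meson less_imp_le order_trans)
      then have "ell v c k (x + s *\<^sub>R (- u)) = S'" using I_val k(1) by blast
      then have "s * - pairing (v k) u = 0"
        using I_val[OF k(1) x(1)] unfolding ell_add_scaleR neg by simp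
      then show False using s(1) k(2) by simp
    qed
    then obtain i where i: "i \<in> I" "0 < pairing (v i) u" by blast
    then have "i \<in> J'" "i \<notin> J" using I_sub by (auto simp: J')
    then show ?thesis using i False by (intro bexI[of _ i]) (auto simp: \<gamma>'_def)
  qed
  have "Q' = Q \<inter> (\<Inter>i\<in>{1..n} - J. {d. S' \<le> ell v c i d})"
    using Q'_S le_fooo_s_iff[OF ne] by blast
  moreover have "closed (\<Inter>i\<in>{1..n} - J. {d. S' \<le> ell v c i d})"
    by (intro closed_INT ballI closed_Collect_le continuous_on_const continuous_on_ell)
  ultimately have "compact Q'" using compact_Q by (simp add: compact_Int_closed)
  then have "fooo_invariant n v c \<gamma>' S' Q' J'"
    unfolding fooo_invariant_def
  proof (intro conjI)
    show "J' \<subseteq> {1..n}" using J I_sub by (auto simp: J')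
    show "Q' = {d. (\<forall>i\<in>J'. ell v c i d = \<gamma>' i) \<and> (\<forall>i\<in>{1..n} - J'. S' \<le> ell v c i d)}"
      using Q'_iff by blast
    show "\<forall>i\<in>J'. \<gamma>' i \<le> S'" using \<gamma>_le S' by (force simp: \<gamma>'_def)
    show "\<exists>d\<in>Q'. \<forall>i\<in>{1..n} - J'. S' < ell v c i d" using x by blast
  qed (use bal in blast)+
  then show ?thesis using sub by blast
qed

end

section \<open>Termination of the construction\<close>

text \<open>If no <v_i,u> were positive, the whole ray from a point of \<open>P\<close> in direction
  -u would stay in \<open>P\<close>.\<close>

lemma bounded_polyhedron_positively_spanning:
  assumes P: "bounded P" "P = (\<Inter>i\<in>{1..n}. {d. 0 \<le> ell v c i d})" "P \<noteq> {}" and u: "(u :: real ^ 'r) \<noteq> 0"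
  shows "\<exists>i\<in>{1..n}. 0 < pairing (v i) u"
proof (rule ccontr)
  assume no: "\<not> ?thesis"
  obtain x where x: "x \<in> P" using P(3) by blast
  obtain B where B: "\<And>y. y \<in> P \<Longrightarrow> norm y \<le> B" using P(1) unfolding bounded_iff by blast
  have "x + s *\<^sub>R (- u) \<in> P" if "0 \<le> s" for s
  proof -
    have "0 \<le> ell v c i (x + s *\<^sub>R (- u))" if i: "i \<in> {1..n}" for i
    proof -
      have "0 \<le> s * - pairing (v i) u"
        using no i \<open>0 \<le> s\<close> by (intro mult_nonneg_nonneg) (auto simp: not_less)
      moreover have "0 \<le> ell v c i x" using x i P(2) by blast
      ultimately show ?thesis unfolding ell_add_scaleR by (simp add: pairing_inner)
    qed
    then show ?thesis using P(2) by blast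
  qed
  then have bound: "norm (x - s *\<^sub>R u) \<le> B" if "0 \<le> s" for s using B that by force
  have B0: "0 \<le> B" using B[OF x] norm_ge_zero order_trans by blast
  define s where "s = (norm x + B + 1) / norm u"
  have s: "0 \<le> s" "s * norm u = norm x + B + 1" using u B0 by (simp_all add: s_def)
  have "norm (s *\<^sub>R u) \<le> norm x + norm (x - s *\<^sub>R u)"
    by (metis add.commute diff_add_cancel norm_minus_commute norm_triangle_ineq norm_triangle_sub)
  then show False using bound[OF s(1)] s by simp
qed

lemma fooo_point_balanced:
  fixes P :: "(real ^ 'r) set"
  assumes P: "polytope P" "aff_dim P = int CARD('r)"
    "P = (\<Inter>i\<in>{1..n}. {d. 0 \<le> ell v c i d})" and v: "\<And>i. i \<in> {1..n} \<Longrightarrow> v i \<noteq> 0"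
  shows "balanced n v c (fooo_point n v c P)"
proof -
  let ?st = "fooo_stage n v c P"
  have int: "interior P \<noteq> {}"
  proof -
    have full: "affine hull P = UNIV" using P(2) aff_dim_eq_full[of P] by simp
    then have "P \<noteq> {}" by force
    then show ?thesis
      using rel_interior_eq_empty[OF polytope_imp_convex[OF P(1)]] rel_interior_interior[OF full] by simp
  qed
  have span: "\<exists>i\<in>{1..n}. 0 < pairing (v i) u" if "u \<noteq> 0" for u :: "real ^ 'r"
    by (rule bounded_polyhedron_positively_spanning[OF polytope_imp_bounded[OF P(1)] P(3) _ that])
       (use int interior_subset in blast)
  have "interior P \<subseteq> {d. 0 < ell v c i d}" if i: "i \<in> {1..n}" for i
  proof -
    have ne: "real_vec (v i) \<noteq> 0" using v[OF i] by (auto simp: vec_eq_iff real_vec_def)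
    have "interior P \<subseteq> interior {d. 0 \<le> ell v c i d}" using i P(3) by (intro interior_mono) blast
    also have "{d. 0 \<le> ell v c i d} = {d. real_vec (v i) \<bullet> d \<ge> - c i}"
      by (auto simp: ell_def pairing_inner)
    also have "interior \<dots> = {d. 0 < ell v c i d}"
      using interior_halfspace_ge[OF ne] by (auto simp: ell_def pairing_inner)
    finally show ?thesis .
  qed
  then have "\<exists>d\<in>P. \<forall>i\<in>{1..n}. 0 < ell v c i d" using int interior_subset by blast
  then have init: "fooo_invariant n v c (\<lambda>_. 0) 0 P {}"
    unfolding fooo_invariant_def using P(3) polytope_imp_compact[OF P(1)] by auto
  \<comment> \<open>Each stage before the first singleton adds an index, and only n indices exist;
    this bounds the number of stages by n + 1.\<close>
  have stage: "(\<exists>\<gamma> S. fooo_invariant n v c \<gamma> S (fst (?st k)) (snd (?st k))) \<and>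
      (is_singleton (fst (?st k)) \<or> k \<le> card (snd (?st k)))" for k
  proof (induction k)
    case 0
    then show ?case using init by auto
  next
    case (Suc k)
    obtain Q J Q' J' where st: "?st k = (Q, J)" "fooo_next n v c (Q, J) = (Q', J')"
      by (metis surj_pair)
    show ?case
    proof (cases "is_singleton Q")
      case True
      then show ?thesis using Suc st by simp
    next
      case False
      obtain \<gamma> S where inv: "fooo_invariant n v c \<gamma> S Q J" using Suc st by auto
      then have "J \<subseteq> {1..n}" unfolding fooo_invariant_def by blast
      moreover have "J \<noteq> {1..n}" using fooo_invariant_full[OF inv span] False by blast
      ultimately have "{1..n} - J \<noteq> {}" by blast
      from fooo_invariant_next[OF inv this st(2)] obtain \<gamma>' S'
        where J': "J \<subset> J'" and inv': "fooo_invariant n v c \<gamma>' S' Q' J'" by blast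
      then have "finite J'" unfolding fooo_invariant_def using finite_subset by blast
      then have "card J < card J'" using J' by (rule psubset_card_mono)
      then show ?thesis using Suc False st inv' by auto
    qed
  qed
  have "is_singleton (fst (?st (Suc n)))"
  proof (rule ccontr)
    assume "\<not> ?thesis"
    then have "Suc n \<le> card (snd (?st (Suc n)))" using stage by blast
    moreover have "snd (?st (Suc n)) \<subseteq> {1..n}"
      using stage[of "Suc n"] unfolding fooo_invariant_def by blast
    then have "card (snd (?st (Suc n))) \<le> n"
      using card_mono[of "{1..n}"] by simp
    ultimately show False by simp
  qed
  then obtain u where u: "fst (?st (Suc n)) = {u}" by (auto simp only: is_singleton_def)
  \<comment> \<open>Any two singleton stages agree with a common later stage, which makes the
    description in \<open>fooo_point\<close> unique.\<close>
  have const: "?st (K + m) = ?st K" if "is_singleton (fst (?st K))" for K m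
    using that by (induction m) auto
  have "fooo_point n v c P = u"
    unfolding fooo_point_def
  proof (rule the_equality)
    fix w assume "\<exists>K. fst (?st K) = {w}"
    then obtain K where K: "fst (?st K) = {w}" ..
    have "?st (K + Suc n) = ?st K" "?st (Suc n + K) = ?st (Suc n)"
      by (rule const, use K u in \<open>simp del: fooo_stage.simps\<close>)+
    then show "w = u" using K u by (metis add.commute singleton_inject)
  qed (use u in blast)
  then show ?thesis using stage[of "Suc n"] u fooo_invariant_singleton by metis
qed

section \<open>Orders and leading coefficients of Puiseux series\<close>

definition order_ge :: "real \<Rightarrow> puiseux \<Rightarrow> bool" where
  "order_ge m f \<longleftrightarrow> (\<forall>x<m. pcoeff f x = 0)"

text \<open>The coefficient may be 0, and then m is only a lower bound for the order. One product
  rule thus serves both orders and leading terms, and data that vanish in degree m fit the same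
  statements.\<close>

definition has_lead :: "puiseux \<Rightarrow> real \<Rightarrow> complex \<Rightarrow> bool" where
  "has_lead f m a \<longleftrightarrow> order_ge m f \<and> pcoeff f m = a"

definition pmonom :: "complex \<Rightarrow> real \<Rightarrow> puiseux" where
  "pmonom a m = Abs_puiseux (\<lambda>x. if x = m then a else 0)"

lemma pcoeff_pmonom: "pcoeff (pmonom a m) x = (if x = m then a else 0)"
  unfolding pmonom_def by (subst pcoeff_Abs) (auto intro: finite_subset[of _ "{m}"])

lemma pcoeff_pmonom_mult: "pcoeff (pmonom a m * f) x = a * pcoeff f (x - m)"
  by (subst pcoeff_monomial_mult[of m]) (simp_all add: pcoeff_pmonom)

lemma pmonom_mult: "pmonom a m * pmonom b k = pmonom (a * b) (m + k)"
  by (rule puiseux_eqI) (auto simp: pcoeff_pmonom_mult pcoeff_pmonom)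

lemma tpow_eq_pmonom: "tpow m = pmonom 1 m"
  by (rule puiseux_eqI) (simp add: pcoeff_tpow pcoeff_pmonom)

lemma pcoeff_of_int_mult: "pcoeff (of_int k * f) x = of_int k * pcoeff f x"
proof -
  have nat: "pcoeff (of_nat m * f) x = of_nat m * pcoeff f x" for m
    by (induction m) (simp_all add: distrib_right)
  show ?thesis
    by (cases k rule: int_cases2) (simp_all add: nat)
qed

lemma pcoeff_pairing: "pcoeff (pairing v y) x = pairing v (\<chi> j. pcoeff (y $ j) x)"
  by (simp add: pairing_def pcoeff_sum_puiseux pcoeff_of_int_mult)

lemma order_ge_0 [simp]: "order_ge m 0"
  by (simp add: order_ge_def)

lemma order_ge_mono: "order_ge m f \<Longrightarrow> k \<le> m \<Longrightarrow> order_ge k f"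
  by (auto simp: order_ge_def)

lemma order_ge_add: "order_ge m f \<Longrightarrow> order_ge m g \<Longrightarrow> order_ge m (f + g)"
  and order_ge_diff: "order_ge m f \<Longrightarrow> order_ge m g \<Longrightarrow> order_ge m (f - g)"
  and order_ge_uminus: "order_ge m f \<Longrightarrow> order_ge m (- f)"
  by (simp_all add: order_ge_def)

lemma order_ge_pairing: "(\<And>j. order_ge m (y $ j)) \<Longrightarrow> order_ge m (pairing v y)"
  by (simp add: order_ge_def pcoeff_pairing) (simp add: pairing_def)

lemma order_ge_1: "m \<le> 0 \<Longrightarrow> order_ge m 1"
  by (simp add: order_ge_def pcoeff_1)

lemma has_lead_mult:
  assumes f: "has_lead f m a" and g: "has_lead g k b"
  shows "has_lead (f * g) (m + k) (a * b)"
proof -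
  have f0: "pcoeff f x = 0" if "x < m" for x using f that by (simp add: has_lead_def order_ge_def)
  have g0: "pcoeff g x = 0" if "x < k" for x using g that by (simp add: has_lead_def order_ge_def)
  have "conv_index f g x = {}" if x: "x < m + k" for x
  proof -
    have "pcoeff f y = 0 \<or> pcoeff g (x - y) = 0" for y
      using f0[of y] g0[of "x - y"] x by (cases "y < m") auto
    then show ?thesis by (auto simp: conv_index_def)
  qed
  then have "order_ge (m + k) (f * g)" by (simp add: order_ge_def pcoeff_mult)
  moreover have "conv_index f g (m + k) \<subseteq> {m}"
  proof -
    have "pcoeff f y = 0 \<or> pcoeff g (m + k - y) = 0" if "y \<noteq> m" for y
      using f0[of y] g0[of "m + k - y"] that by (cases "y < m") auto
    then show ?thesis by (auto simp: conv_index_def)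
  qed
  then have "pcoeff (f * g) (m + k) = a * b"
    using pcoeff_mult_superset[of "{m}" f g "m + k"] f g by (simp add: has_lead_def)
  ultimately show ?thesis by (simp add: has_lead_def)
qed

lemma order_ge_mult: "order_ge m f \<Longrightarrow> order_ge k g \<Longrightarrow> order_ge (m + k) (f * g)"
  using has_lead_mult by (auto simp: has_lead_def)

lemma has_lead_1: "has_lead 1 0 1"
  by (simp add: has_lead_def order_ge_def pcoeff_1)

lemma has_lead_nonzero: "has_lead f m a \<Longrightarrow> a \<noteq> 0 \<Longrightarrow> f \<noteq> 0"
  by (auto simp: has_lead_def)

lemma has_lead_unique:
  "has_lead f m a \<Longrightarrow> has_lead f k b \<Longrightarrow> a \<noteq> 0 \<Longrightarrow> b \<noteq> 0 \<Longrightarrow> m = k \<and> a = b"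
  unfolding has_lead_def order_ge_def by (metis linorder_less_linear)

lemma has_lead_val: "f \<noteq> 0 \<Longrightarrow> has_lead f (val f) (pcoeff f (val f))"
  using val_le[of f] by (auto simp: has_lead_def order_ge_def not_le[symmetric])

lemma val_eqI: "has_lead f m a \<Longrightarrow> a \<noteq> 0 \<Longrightarrow> val f = m"
  using has_lead_val[of f] pcoeff_val_nonzero[of f] has_lead_nonzero has_lead_unique by metis

lemma has_lead_inverse:
  assumes f: "has_lead f m a" and a: "a \<noteq> 0"
  shows "has_lead (inverse f) (- m) (inverse a)"
proof -
  have f0: "f \<noteq> 0" using has_lead_nonzero[OF f a] .
  let ?k = "val (inverse f)" and ?b = "pcoeff (inverse f) (val (inverse f))"
  have b: "?b \<noteq> 0" using f0 by (simp add: pcoeff_val_nonzero)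
  have lead: "has_lead (inverse f) ?k ?b" using f0 by (simp add: has_lead_val)
  have "has_lead 1 (m + ?k) (a * ?b)"
    using has_lead_mult[OF f lead] f0 by simp
  then have eq: "m + ?k = 0 \<and> a * ?b = 1"
    using has_lead_unique[OF _ has_lead_1] a b by simp
  then have "?k = - m" by linarith
  moreover have "?b = inverse a" using eq a by (simp add: field_simps)
  ultimately show ?thesis using lead by simp
qed

lemma has_lead_power_int:
  assumes f: "has_lead f m a" and a: "a \<noteq> 0"
  shows "has_lead (f powi k) (of_int k * m) (a powi k)"
proof -
  have nat: "has_lead (f ^ i) (of_nat i * m) (a ^ i)" for i
    by (induction i) (use has_lead_1 has_lead_mult[OF f] in \<open>simp_all add: distrib_right\<close>)
  show ?thesis
  proof (cases k rule: int_cases2)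
    case (nonpos i)
    then show ?thesis
      using has_lead_inverse[OF nat[of i]] a by (simp add: power_int_minus)
  qed (use nat in simp)
qed

lemma has_lead_prod:
  "finite A \<Longrightarrow> (\<And>j. j \<in> A \<Longrightarrow> has_lead (f j) (m j) (a j)) \<Longrightarrow>
    has_lead (\<Prod>j\<in>A. f j) (\<Sum>j\<in>A. m j) (\<Prod>j\<in>A. a j)"
  by (induction A rule: finite_induct) (simp_all add: has_lead_1 has_lead_mult)

text \<open>Finitely many coordinates have together only finitely many exponents up to x. The vector
  of coefficients in degree m is the nonzero lowest coefficient of y.\<close>

lemma least_exponent:
  fixes y :: "puiseux ^ 'r"
  assumes "pcoeff (y $ j) x \<noteq> 0"
  obtains m k where "m \<le> x" "pcoeff (y $ k) m \<noteq> 0" "\<And>j. order_ge m (y $ j)"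
proof -
  let ?B = "\<Union>j. {z. pcoeff (y $ j) z \<noteq> 0 \<and> z \<le> x}"
  have fin: "finite ?B" by (intro finite_UN_I finite_pcoeff_le finite_class.finite_UNIV)
  have "x \<in> ?B" using assms by auto
  then have "?B \<noteq> {}" "Min ?B \<le> x" using fin by auto
  moreover have "Min ?B \<in> ?B" using Min_in[OF fin] calculation by blast
  moreover have "order_ge (Min ?B) (y $ j)" for j
    unfolding order_ge_def
  proof (intro allI impI, rule ccontr)
    fix z assume z: "z < Min ?B" "pcoeff (y $ j) z \<noteq> 0"
    then have "z \<in> ?B" using \<open>Min ?B \<le> x\<close> by auto
    then show False using Min_le[OF fin] z(1) by fastforce
  qed
  ultimately show ?thesis using that[of "Min ?B"] by blast
qed

text \<open>Coefficients below degree k e no longer change from stage k on. The limit reads each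
  coefficient at a late enough stage; up to any bound b it agrees with a single series, which gives
  admissibility of its exponents.\<close>

lemma puiseux_Cauchy_limit:
  assumes e: "0 < e" and step: "\<And>k. order_ge (real k * e) (f (Suc k) - f k)"
  shows "\<exists>g. \<forall>k. order_ge (real k * e) (g - f k)"
proof -
  have stable: "pcoeff (f (k + i)) x = pcoeff (f k) x" if "x < real k * e" for k i x
  proof (induction i)
    case (Suc i)
    have "real k * e \<le> real (k + i) * e" using e by (intro mult_right_mono) auto
    then have "x < real (k + i) * e" using that by linarith
    then show ?case using step[of "k + i"] Suc by (simp add: order_ge_def)
  qed simp
  have stable': "pcoeff (f k) x = pcoeff (f i) x" if "x < real k * e" "x < real i * e" for k i x
  proof (cases "k \<le> i")
    case True
    then show ?thesis using stable[OF that(1), of "i - k"] by simp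
  next
    case False
    then show ?thesis using stable[OF that(2), of "k - i"] by simp
  qed
  have "\<exists>k. x < real k * e" for x using reals_Archimedean3[OF e] by blast
  then obtain N where N: "\<And>x. x < real (N x) * e" by metis
  define F where "F x = pcoeff (f (N x)) x" for x
  have "finite {x. F x \<noteq> 0 \<and> x \<le> b}" for b
  proof (rule finite_subset[OF _ finite_pcoeff_le[of "f (N b)" b]])
    have "F x = pcoeff (f (N b)) x" if "x \<le> b" for x
      unfolding F_def by (rule stable'[OF N]) (use N[of b] that in simp)
    then show "{x. F x \<noteq> 0 \<and> x \<le> b} \<subseteq> {x. pcoeff (f (N b)) x \<noteq> 0 \<and> x \<le> b}"
      by auto
  qed
  then have "pcoeff (Abs_puiseux F) = F" by (rule pcoeff_Abs)
  then have "order_ge (real k * e) (Abs_puiseux F - f k)" for k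
    using stable'[OF N] by (simp add: order_ge_def F_def)
  then show ?thesis by blast
qed

lemma eq_0_if_order_ge_multiples:
  assumes "0 < e" "\<And>k. order_ge (real k * e) f"
  shows "f = 0"
proof (rule puiseux_eqI)
  fix x
  obtain k where "x < real k * e" using reals_Archimedean3[OF assms(1)] by blast
  then show "pcoeff f x = pcoeff 0 x" using assms(2)[of k] by (simp add: order_ge_def)
qed

text \<open>\<open>L\<close> is the difference \<open>f - f'\<close> up to a relative error of order \<open>e\<close>, where \<open>f\<close>
  and \<open>f'\<close> are \<open>1 + O(t\<^sup>e)\<close>: the logarithmic derivative, hence additive in products.\<close>

definition log_diff :: "real \<Rightarrow> real \<Rightarrow> puiseux \<Rightarrow> puiseux \<Rightarrow> puiseux \<Rightarrow> bool" where
  "log_diff e m f f' L \<longleftrightarrow> order_ge e (f - 1) \<and> order_ge e (f' - 1) \<and> order_ge m L \<and>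
     order_ge (m + e) (f - f' - L)"

lemma order_ge_0_if_near_1: "0 \<le> e \<Longrightarrow> order_ge e (f - 1) \<Longrightarrow> order_ge 0 f"
  using order_ge_add[of 0 "f - 1" 1] by (simp add: order_ge_1 order_ge_mono)

lemma has_lead_if_near_1: "0 < e \<Longrightarrow> order_ge e (f - 1) \<Longrightarrow> has_lead f 0 1"
  using order_ge_0_if_near_1[of e f] by (auto simp: has_lead_def order_ge_def pcoeff_1)

context
  fixes e :: real
  assumes e: "0 < e"
begin

lemma log_diff_1: "log_diff e m 1 1 0"
  by (simp add: log_diff_def)

lemma log_diff_mult:
  assumes f: "log_diff e m f f' L" and g: "log_diff e m g g' M"
  shows "log_diff e m (f * g) (f' * g') (L + M)"
proof -
  have near: "order_ge 0 f'" "order_ge 0 g" "order_ge 0 f"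
    using f g e order_ge_0_if_near_1[of e] by (auto simp: log_diff_def)
  have "f * g - 1 = f * (g - 1) + (f - 1)" "f' * g' - 1 = f' * (g' - 1) + (f' - 1)"
    by (simp_all add: algebra_simps)
  then have "order_ge e (f * g - 1)" "order_ge e (f' * g' - 1)"
    using order_ge_add[OF order_ge_mult[OF near(3), of e "g - 1"], of "f - 1"]
      order_ge_add[OF order_ge_mult[OF near(1), of e "g' - 1"], of "f' - 1"] f g
    by (simp_all only: log_diff_def add_0)
  moreover have "f * g - f' * g' - (L + M) =
      (f - f' - L) * g + L * (g - 1) + f' * (g - g' - M) + (f' - 1) * M"
    by (simp add: algebra_simps)
  moreover have "order_ge (m + e) ((f - f' - L) * g)" "order_ge (m + e) (L * (g - 1))"
    "order_ge (m + e) (f' * (g - g' - M))" "order_ge (m + e) ((f' - 1) * M)"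
    using order_ge_mult[of "m + e" "f - f' - L" 0 g] order_ge_mult[of m L e "g - 1"]
      order_ge_mult[of 0 f' "m + e" "g - g' - M"] order_ge_mult[of e "f' - 1" m M] f g near
    by (simp_all add: log_diff_def add.commute)
  ultimately show ?thesis using f g by (simp add: log_diff_def order_ge_add)
qed

lemma log_diff_inverse:
  assumes f: "log_diff e m f f' L"
  shows "log_diff e m (inverse f) (inverse f') (- L)"
proof -
  have lead: "has_lead f 0 1" "has_lead f' 0 1"
    using f has_lead_if_near_1[OF e] by (auto simp: log_diff_def)
  then have nz: "f \<noteq> 0" "f' \<noteq> 0" using has_lead_nonzero by force+
  have ge: "order_ge 0 (inverse f)" "order_ge 0 (inverse f')"
    using has_lead_inverse[of _ 0 1] lead by (auto simp: has_lead_def)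
  have inv: "order_ge e (inverse h - 1)" if "order_ge e (h - 1)" "h \<noteq> 0" "order_ge 0 (inverse h)" for h
  proof -
    have "inverse h - 1 = inverse h * - (h - 1)" using that(2) by (simp add: field_simps)
    then show ?thesis
      using order_ge_mult[OF that(3) order_ge_uminus[OF that(1)]] by simp
  qed
  have ff: "order_ge e (f * f' - 1)"
  proof -
    have "f * f' - 1 = f * (f' - 1) + (f - 1)" by (simp add: algebra_simps)
    then show ?thesis
      using order_ge_add[OF order_ge_mult[of 0 f e "f' - 1"], of "f - 1"] f lead
      by (simp only: log_diff_def has_lead_def add_0)
  qed
  \<comment> \<open>Clearing denominators leaves the given error and the product of L with f f' - 1,
    and both have order at least m + e.\<close>
  have "inverse f - inverse f' - - L = inverse f * inverse f' * (L * (f * f' - 1) - (f - f' - L))"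
    using nz by (simp add: field_simps)
  moreover have "order_ge (m + e) (L * (f * f' - 1) - (f - f' - L))"
    using f order_ge_mult[OF _ ff, of m L] by (simp add: log_diff_def order_ge_diff)
  ultimately have "order_ge (m + e) (inverse f - inverse f' - - L)"
    using order_ge_mult[OF order_ge_mult[OF ge]] by (metis add_0)
  then show ?thesis using f inv nz ge by (simp add: log_diff_def order_ge_uminus)
qed

lemma log_diff_power_int:
  assumes f: "log_diff e m f f' L"
  shows "log_diff e m (f powi k) (f' powi k) (of_int k * L)"
proof -
  have nat: "log_diff e m (f ^ i) (f' ^ i) (of_nat i * L)" for i
    by (induction i) (use log_diff_1 log_diff_mult[OF f] in \<open>simp_all add: distrib_right\<close>)
  show ?thesis
  proof (cases k rule: int_cases2)
    case (nonpos i)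
    then show ?thesis using log_diff_inverse[OF nat[of i]] by (simp add: power_int_minus)
  qed (use nat in simp)
qed

lemma log_diff_prod:
  "finite A \<Longrightarrow> (\<And>j. j \<in> A \<Longrightarrow> log_diff e m (f j) (f' j) (L j)) \<Longrightarrow>
    log_diff e m (\<Prod>j\<in>A. f j) (\<Prod>j\<in>A. f' j) (\<Sum>j\<in>A. L j)"
  by (induction A rule: finite_induct) (simp_all add: log_diff_1 log_diff_mult)

end

section \<open>Laurent monomials and the leading data of torus points\<close>

definition laurent_monomial :: "int ^ 'r \<Rightarrow> 'a::field ^ 'r \<Rightarrow> 'a" where
  "laurent_monomial v x = (\<Prod>j\<in>UNIV. (x $ j) powi (v $ j))"

lemma laurent_monomial_1 [simp]: "laurent_monomial v 1 = 1"
  by (simp add: laurent_monomial_def)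

lemma laurent_monomial_add:
  assumes "\<And>j. x $ j \<noteq> 0"
  shows "laurent_monomial (v + w) x = laurent_monomial v x * laurent_monomial w x"
  by (simp add: laurent_monomial_def power_int_add assms prod.distrib)

lemma log_diff_laurent_monomial:
  assumes "0 < e" "\<And>j. log_diff e m (x $ j) (y $ j) (L $ j)"
  shows "log_diff e m (laurent_monomial v x) (laurent_monomial v y) (pairing v L)"
  unfolding laurent_monomial_def pairing_def
  by (intro log_diff_prod log_diff_power_int assms finite_class.finite_UNIV)

lemma has_lead_laurent_monomial:
  assumes "\<And>j. has_lead (x $ j) (d $ j) (of_real (exp (b $ j)))"
  shows "has_lead (laurent_monomial v x) (pairing v d) (of_real (exp (pairing v b)))"
proof -
  have "has_lead (laurent_monomial v x) (\<Sum>j\<in>UNIV. of_int (v $ j) * d $ j)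
      (\<Prod>j\<in>UNIV. of_real (exp (b $ j)) powi (v $ j))"
    unfolding laurent_monomial_def
    by (intro has_lead_prod has_lead_power_int assms finite_class.finite_UNIV) simp
  then show ?thesis
    by (simp add: pairing_def exp_sum exp_power_int flip: of_real_power_int of_real_prod)
qed

lemma torus_eq_laurent_monomial:
  assumes p: "p \<in> torus"
  shows "p v = laurent_monomial v (\<chi> j. p (axis j 1))"
proof -
  have add: "p (v + w) = p v * p w" and nz: "p v \<noteq> 0" for v w using p by (auto simp: torus_def)
  have zero: "p 0 = 1" using add[of 0 0] nz[of 0] by simp
  have nat: "p (int i *s v) = p v ^ i" for i v
    by (induction i) (simp_all add: zero add vector_sadd_rdistrib)
  have int: "p (k *s v) = p v powi k" for k v
  proof (cases k rule: int_cases2)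
    case (nonpos i)
    have "p (k *s v) * p (int i *s v) = 1"
      using add[of "k *s v" "int i *s v"] zero nonpos by (simp flip: vector_sadd_rdistrib)
    then show ?thesis
      using nonpos nz by (simp add: nat power_int_minus field_simps)
  qed (simp add: nat)
  have "p (\<Sum>j\<in>A. (v $ j) *s axis j 1) = (\<Prod>j\<in>A. p (axis j 1) powi (v $ j))" if "finite A" for A
    using that by (induction A rule: finite_induct) (simp_all add: zero add int)
  then show ?thesis
    using basis_expansion[of v] by (metis (no_types, lifting) finite_class.finite_UNIV
      laurent_monomial_def prod.cong vec_lambda_beta)
qed

text \<open>Positive leading coefficients have real logarithms, so the leading part of p is given by
  two real vectors: the valuation d and the logarithm b. The values on the standard basis determine
  both.\<close>

lemma torus_pos_lead:
  assumes p: "p \<in> torus_pos"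
  obtains d b where "\<And>v. has_lead (p v) (pairing v d) (of_real (exp (pairing v b)))"
proof -
  have "\<exists>m r. has_lead (p v) m (of_real (exp r))" for v
  proof -
    obtain a :: real where a: "0 < a" "p v \<noteq> 0" "pcoeff (p v) (val (p v)) = of_real a"
      using p by (auto simp: torus_pos_def puiseux_pos_def)
    then have "has_lead (p v) (val (p v)) (of_real (exp (ln a)))"
      using has_lead_val[of "p v"] by (metis exp_ln)
    then show ?thesis by blast
  qed
  then obtain m r where mr: "\<And>v. has_lead (p v) (m v) (of_real (exp (r v)))" by metis
  have "has_lead (laurent_monomial v (\<chi> j. p (axis j 1))) (pairing v (\<chi> j. m (axis j 1)))
      (of_real (exp (pairing v (\<chi> j. r (axis j 1)))))" for v
    by (rule has_lead_laurent_monomial) (simp add: mr)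
  moreover have "p \<in> torus" using p by (simp add: torus_pos_def)
  ultimately have "has_lead (p v) (pairing v (\<chi> j. m (axis j 1)))
      (of_real (exp (pairing v (\<chi> j. r (axis j 1)))))" for v
    by (simp only: torus_eq_laurent_monomial[of p v])
  then show ?thesis by (rule that)
qed

section \<open>Uniqueness of the positive critical point\<close>

lemma pairing_minus: "pairing v (- x) = - pairing v x"
  by (simp add: pairing_def sum_negf)

lemma pairing_diff: "pairing v (x - y) = pairing v x - pairing v y"
  by (simp add: pairing_def algebra_simps sum_subtractf)

lemma pairing_zero [simp]: "pairing v 0 = 0"
  by (simp add: pairing_def)

lemma pairing_of_real: "pairing v (\<chi> j. of_real (x $ j)) = of_real (pairing v x)"
  by (simp add: pairing_def)

lemma pairing_cnj: "pairing v (\<chi> j. cnj (w $ j)) = cnj (pairing v w)"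
  by (simp add: pairing_def)

lemma Re_pairing: "Re (pairing v w) = pairing v (\<chi> j. Re (w $ j))"
  and Im_pairing: "Im (pairing v w) = pairing v (\<chi> j. Im (w $ j))"
  by (simp_all add: pairing_def)

lemma pairing_axis: "pairing v (axis j 1 :: 'a::comm_ring_1 ^ 'r) = of_int (v $ j)"
proof -
  have "pairing v (axis j 1) = (\<Sum>k\<in>UNIV. if k = j then of_int (v $ k) else (0 :: 'a))"
    unfolding pairing_def by (rule sum.cong) (auto simp: axis_def)
  then show ?thesis by simp
qed

text \<open>In a single degree x the equations are linear over the complex numbers and may be
  contracted with any complex vector, in particular with the conjugate of a lowest
  coefficient.\<close>

lemma pairing_coeff_sum_eq_0:
  assumes "\<And>j. (\<Sum>i\<in>I. f i * of_int (v i $ j)) = (0 :: puiseux)"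
  shows "(\<Sum>i\<in>I. pairing (v i) z * pcoeff (f i) x) = 0"
proof -
  have "(\<Sum>i\<in>I. of_int (v i $ j) * pcoeff (f i) x) = 0" for j
  proof -
    have "pcoeff (\<Sum>i\<in>I. of_int (v i $ j) * f i) x = 0" using assms[of j] by (simp add: mult.commute)
    then show ?thesis by (simp add: pcoeff_sum_puiseux pcoeff_of_int_mult)
  qed
  then have "(\<Sum>j\<in>UNIV. z $ j * (\<Sum>i\<in>I. of_int (v i $ j) * pcoeff (f i) x)) = 0" by simp
  then show ?thesis
    unfolding sum_distrib_left
    by (subst (asm) sum.swap) (simp add: pairing_def sum_distrib_right sum_distrib_left mult_ac)
qed

text \<open>In the lowest exponent that occurs only positive reals are added, so nothing can
  cancel.\<close>

lemma positive_lead_sum_nonzero: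
  assumes fin: "finite I" and sum: "\<And>x. (\<Sum>i\<in>I. z i * pcoeff (f i) x) = 0"
    and lead: "\<And>i. i \<in> I \<Longrightarrow> z i \<noteq> 0 \<Longrightarrow> \<exists>m a. has_lead (f i) m a \<and> (\<exists>r>0. z i * a = of_real r)"
  shows "\<forall>i\<in>I. z i = 0"
proof (rule ccontr)
  let ?K = "{i \<in> I. z i \<noteq> 0}"
  assume "\<not> ?thesis"
  then have K: "finite ?K" "?K \<noteq> {}" using fin by auto
  obtain m r where mr: "\<And>i. i \<in> ?K \<Longrightarrow> (\<exists>a. has_lead (f i) (m i) a \<and> 0 < r i \<and> z i * a = of_real (r i))"
    using lead by (simp add: Ball_def) metis
  define \<mu> where "\<mu> = Min (m ` ?K)"
  have le: "\<mu> \<le> m i" if "i \<in> ?K" for i unfolding \<mu>_def using K that by simp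
  have "\<mu> \<in> m ` ?K" unfolding \<mu>_def using K by (intro Min_in) auto
  then obtain k where k: "k \<in> ?K" "m k = \<mu>" by auto
  have summand: "z i * pcoeff (f i) \<mu> = of_real (if m i = \<mu> then r i else 0)" if "i \<in> ?K" for i
    using mr[OF that] le[OF that] by (auto simp: has_lead_def order_ge_def)
  have "(\<Sum>i\<in>I. z i * pcoeff (f i) \<mu>) = (\<Sum>i\<in>?K. z i * pcoeff (f i) \<mu>)"
    by (rule sum.mono_neutral_right) (use fin in auto)
  also have "\<dots> = of_real (\<Sum>i\<in>?K. if m i = \<mu> then r i else 0)"
    unfolding of_real_sum by (rule sum.cong[OF refl summand])
  finally have "(\<Sum>i\<in>?K. if m i = \<mu> then r i else 0) = 0" using sum by (metis of_real_eq_0_iff)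
  moreover have "0 < (\<Sum>i\<in>?K. if m i = \<mu> then r i else 0)"
    using mr k by (intro sum_pos2[OF K(1) k(1)]) (auto intro: less_imp_le)
  ultimately show False by simp
qed

lemma has_lead_minus_1:
  assumes "has_lead f m a"
  shows "m < 0 \<Longrightarrow> has_lead (f - 1) m a"
    and "m = 0 \<Longrightarrow> has_lead (f - 1) 0 (a - 1)"
    and "0 < m \<Longrightarrow> has_lead (f - 1) 0 (- 1)"
  using assms by (auto simp: has_lead_def order_ge_def pcoeff_1)

text \<open>Strict convexity of \<open>W\<close> along the positive torus: two critical points differ by a factor
  \<open>q\<close> whose lowest deviation from \<open>1\<close>, be it the valuation, the logarithm of the leading
  coefficient or the first correction term, is a direction in which all terms of
  \<open>W'(p q) - W'(p)\<close> are positive.\<close>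

lemma positive_critical_point_unique:
  fixes v :: "nat \<Rightarrow> int ^ 'r"
  assumes span: "\<And>u :: real ^ 'r. u \<noteq> 0 \<Longrightarrow> \<exists>i\<in>{1..n}. pairing (v i) u \<noteq> 0"
    and p: "p \<in> torus_pos" "critical_point (superpotential n v c) p"
    and p': "p' \<in> torus_pos" "critical_point (superpotential n v c) p'"
  shows "p = p'"
proof -
  have crit: "(\<Sum>i\<in>{1..n}. (tpow (c i) * s (v i)) * of_int (v i $ j)) = 0"
    if "critical_point (superpotential n v c) s" for s j
  proof -
    have "(\<Sum>i\<in>{1..n}. tpow (c i) * of_int (pairing (v i) (axis j 1)) * s (v i)) = 0"
      using that unfolding critical_point_superpotential by blast
    then show ?thesis by (simp add: pairing_axis mult_ac)
  qed
  have tor: "p \<in> torus" "p' \<in> torus" using p p' by (auto simp: torus_pos_def)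
  define q where "q w = p' w / p w" for w
  have pnz: "p w \<noteq> 0" for w using tor by (auto simp: torus_def)
  have q: "q \<in> torus" using tor by (auto simp: torus_def q_def)
  obtain d b where lead: "\<And>w. has_lead (p w) (pairing w d) (of_real (exp (pairing w b)))"
    using torus_pos_lead[OF p(1)] by blast
  obtain d' b' where lead': "\<And>w. has_lead (p' w) (pairing w d') (of_real (exp (pairing w b')))"
    using torus_pos_lead[OF p'(1)] by blast
  have q_lead: "has_lead (q w) (pairing w (d' - d)) (of_real (exp (pairing w (b' - b))))" for w
    using has_lead_mult[OF lead'[of w] has_lead_inverse[OF lead[of w]]]
    by (simp add: q_def pairing_diff exp_diff field_simps)
  define f where "f i = tpow (c i) * p (v i) * (q (v i) - 1)" for i
  have f: "f i = tpow (c i) * p' (v i) - tpow (c i) * p (v i)" for i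
    using pnz by (simp add: f_def q_def field_simps)
  have "(\<Sum>i\<in>{1..n}. f i * of_int (v i $ j)) = 0" for j
    unfolding f left_diff_distrib sum_subtractf using crit[OF p(2)] crit[OF p'(2)] by simp
  then have sum: "(\<Sum>i\<in>{1..n}. pairing (v i) z * pcoeff (f i) x) = 0" for z x
    by (rule pairing_coeff_sum_eq_0)
  have span_complex: "z = 0" if "\<forall>i\<in>{1..n}. pairing (v i) z = 0" for z :: "complex ^ 'r"
  proof -
    have "(\<chi> j. Re (z $ j)) = 0" "(\<chi> j. Im (z $ j)) = 0"
      using span[of "\<chi> j. Re (z $ j)"] span[of "\<chi> j. Im (z $ j)"] that
      by (auto simp flip: Re_pairing Im_pairing)
    then show ?thesis by (simp add: vec_eq_iff complex_eq_iff)
  qed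
  \<comment> \<open>The factor t^(c_i) p^(v_i) has a positive leading coefficient, so the sign
    condition on q^(v_i) - 1 passes to \<open>f i\<close>.\<close>
  have conclude: "z = 0"
    if pos: "\<And>i. i \<in> {1..n} \<Longrightarrow> pairing (v i) z \<noteq> 0 \<Longrightarrow>
      \<exists>m a. has_lead (q (v i) - 1) m a \<and> (\<exists>r>0. pairing (v i) z * a = of_real r)" for z
  proof -
    have "\<forall>i\<in>{1..n}. pairing (v i) z = 0"
    proof (rule positive_lead_sum_nonzero[OF _ sum])
      fix i assume "i \<in> {1..n}" "pairing (v i) z \<noteq> 0"
      then obtain m a r where m: "has_lead (q (v i) - 1) m a" "0 < r" "pairing (v i) z * a = of_real r"
        using pos by blast
      have "has_lead (tpow (c i)) (c i) 1" by (simp add: has_lead_def order_ge_def pcoeff_tpow)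
      then have "has_lead (f i) (c i + pairing (v i) d + m) (1 * of_real (exp (pairing (v i) b)) * a)"
        unfolding f_def by (intro has_lead_mult lead m(1))
      moreover have "pairing (v i) z * (1 * of_real (exp (pairing (v i) b)) * a) =
          of_real (r * exp (pairing (v i) b))"
        using m(3) by (simp add: mult_ac)
      ultimately show "\<exists>m a. has_lead (f i) m a \<and> (\<exists>r>0. pairing (v i) z * a = of_real r)"
        using m(2) by (meson exp_gt_zero mult_pos_pos)
    qed simp
    then show ?thesis by (rule span_complex)
  qed
  have conclude_real: "x = 0"
    if pos: "\<And>i. pairing (v i) x \<noteq> 0 \<Longrightarrow>
      \<exists>m s. has_lead (q (v i) - 1) m (of_real s) \<and> 0 < pairing (v i) x * s" for x :: "real ^ 'r"
  proof -
    have "(\<chi> j. complex_of_real (x $ j)) = 0"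
    proof (rule conclude)
      fix i assume "pairing (v i) (\<chi> j. complex_of_real (x $ j)) \<noteq> 0"
      then have "pairing (v i) x \<noteq> 0" by (simp add: pairing_of_real)
      then obtain m s where "has_lead (q (v i) - 1) m (of_real s)" "0 < pairing (v i) x * s"
        using pos by blast
      moreover have "pairing (v i) (\<chi> j. complex_of_real (x $ j)) * of_real s = of_real (pairing (v i) x * s)"
        by (simp add: pairing_of_real)
      ultimately show "\<exists>m a. has_lead (q (v i) - 1) m a \<and>
          (\<exists>r>0. pairing (v i) (\<chi> j. complex_of_real (x $ j)) * a = of_real r)"
        by blast
    qed
    then show ?thesis by (simp add: vec_eq_iff)
  qed
  \<comment> \<open>The series q^(v_i) - 1 has leading coefficient e^<v_i,b'-b> if q^(v_i) has
    negative valuation and -1 if it has positive valuation: the sign is always that of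
    -<v_i,d'-d>.\<close>
  have "- (d' - d) = 0"
  proof (rule conclude_real)
    fix i assume "pairing (v i) (- (d' - d)) \<noteq> 0"
    then consider "pairing (v i) (d' - d) < 0" | "0 < pairing (v i) (d' - d)"
      unfolding pairing_minus by linarith
    then show "\<exists>m s. has_lead (q (v i) - 1) m (of_real s) \<and> 0 < pairing (v i) (- (d' - d)) * s"
    proof cases
      case 1
      then have "0 < pairing (v i) (- (d' - d)) * exp (pairing (v i) (b' - b))"
        unfolding pairing_minus by (simp add: mult_neg_pos)
      then show ?thesis using has_lead_minus_1(1)[OF q_lead 1] by blast
    next
      case 2
      then have "0 < pairing (v i) (- (d' - d)) * - 1" unfolding pairing_minus by simp
      moreover have "has_lead (q (v i) - 1) 0 (of_real (- 1))"
        using has_lead_minus_1(3)[OF q_lead 2] by simp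
      ultimately show ?thesis by blast
    qed
  qed
  then have d: "d' - d = 0" by (simp only: neg_equal_0_iff_equal)
  have b: "b' - b = 0"
  proof (rule conclude_real)
    fix i
    let ?s = "pairing (v i) (b' - b)"
    assume "?s \<noteq> 0"
    then have "0 < ?s * (exp ?s - 1)" by (cases "0 < ?s") (auto intro: mult_neg_neg)
    moreover have "has_lead (q (v i) - 1) 0 (of_real (exp ?s - 1))"
      using has_lead_minus_1(2)[OF q_lead[of "v i"]] d by simp
    ultimately show "\<exists>m s. has_lead (q (v i) - 1) m (of_real s) \<and> 0 < ?s * s" by blast
  qed
  define h where "h = (\<chi> j. q (axis j 1) - 1)"
  have q_lead_1: "has_lead (q w) 0 1" for w using q_lead[of w] d b by simp
  have h0: "pcoeff (h $ j) x = 0" if "x \<le> 0" for j x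
    using q_lead_1[of "axis j 1"] that
    by (cases "x = 0") (auto simp: h_def has_lead_def order_ge_def pcoeff_1)
  have "h = 0"
  proof (rule ccontr)
    assume "h \<noteq> 0"
    then obtain j x where "pcoeff (h $ j) x \<noteq> 0"
      by (metis pcoeff_0 puiseux_eqI vec_eq_iff zero_index)
    then obtain m k where m: "pcoeff (h $ k) m \<noteq> 0" "\<And>j. order_ge m (h $ j)"
      using least_exponent by blast
    have "0 < m" using h0 m(1) by (meson not_le)
    define w where "w = (\<chi> j. pcoeff (h $ j) m)"
    \<comment> \<open>Both parameters of \<open>log_diff\<close> are m, so q^(v_i) is 1 + <v_i,h> up
      to order 2m. Since w is complex, it is tested against its conjugate, which gives the squares
      of the absolute values of <v_i,w>.\<close>
    have "has_lead (q (v i) - 1) m (pairing (v i) w)" for i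
    proof -
      let ?L = "pairing (v i) h"
      have "log_diff m m (laurent_monomial (v i) (\<chi> j. q (axis j 1))) (laurent_monomial (v i) 1) ?L"
        by (rule log_diff_laurent_monomial[OF \<open>0 < m\<close>]) (use m(2) in \<open>simp add: log_diff_def h_def\<close>)
      then have "order_ge (m + m) (q (v i) - 1 - ?L)" "order_ge m (q (v i) - 1)"
        using torus_eq_laurent_monomial[OF q, of "v i"] by (simp_all add: log_diff_def)
      moreover have "pcoeff ?L m = pairing (v i) w" by (simp add: pcoeff_pairing w_def)
      ultimately show ?thesis using \<open>0 < m\<close> by (simp add: has_lead_def order_ge_def)
    qed
    moreover have "\<exists>r>0. pairing (v i) (\<chi> j. cnj (w $ j)) * pairing (v i) w = of_real r"
      if "pairing (v i) (\<chi> j. cnj (w $ j)) \<noteq> 0" for i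
      using that by (intro exI[of _ "(cmod (pairing (v i) w))\<^sup>2"])
        (simp add: pairing_cnj complex_norm_square mult.commute del: of_real_power)
    ultimately have "(\<chi> j. cnj (w $ j)) = 0" by (intro conclude) blast
    then show False using m(1) by (simp add: vec_eq_iff w_def)
  qed
  then have "(\<chi> j. q (axis j 1)) = 1" by (simp add: h_def vec_eq_iff)
  then have "q w = 1" for w using torus_eq_laurent_monomial[OF q, of w] by simp
  then show ?thesis using pnz by (simp add: q_def fun_eq_iff)
qed

section \<open>Lifting a balanced point to a critical point\<close>

context
  fixes n :: nat and v :: "nat \<Rightarrow> int ^ 'r" and \<alpha> l :: "nat \<Rightarrow> real"
  assumes span: "\<And>u :: real ^ 'r. u \<noteq> 0 \<Longrightarrow> \<exists>i\<in>{1..n}. pairing (v i) u \<noteq> 0"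
    and \<alpha>_pos: "\<And>i. 0 < \<alpha> i"
    and graded_crit: "\<And>(u :: real ^ 'r) \<delta>. (\<And>i. i \<in> {1..n} \<Longrightarrow> pairing (v i) u \<noteq> 0 \<Longrightarrow> \<delta> \<le> l i) \<Longrightarrow>
      (\<Sum>i\<in>{i\<in>{1..n}. l i = \<delta>}. pairing (v i) u * \<alpha> i) = 0"
begin

private abbreviation a :: "nat \<Rightarrow> puiseux" where
  "a i \<equiv> pmonom (of_real (\<alpha> i)) (l i)"

text \<open>These are the normal equations of minimising sum_i a_i (<v_i,y> - g_i)^2, where the
  weights are the leading terms of t^(c_i) p^(v_i).\<close>

private definition least_squares :: "(nat \<Rightarrow> puiseux) \<Rightarrow> puiseux ^ 'r \<Rightarrow> bool" where
  "least_squares g y \<longleftrightarrow>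
     (\<forall>j. (\<Sum>i\<in>{1..n}. a i * (pairing (v i) y - g i) * of_int (v i $ j)) = 0)"

private lemma least_squares_diff:
  "least_squares g y \<Longrightarrow> least_squares g' y' \<Longrightarrow> least_squares (\<lambda>i. g i - g' i) (y - y')"
proof -
  have "a i * (pairing (v i) (y - y') - (g i - g' i)) * of_int (v i $ j) =
      a i * (pairing (v i) y - g i) * of_int (v i $ j) -
      a i * (pairing (v i) y' - g' i) * of_int (v i $ j)" for i j
    by (simp add: pairing_diff algebra_simps)
  then show "least_squares g y \<Longrightarrow> least_squares g' y' \<Longrightarrow> ?thesis"
    by (simp add: least_squares_def sum_subtractf)
qed

text \<open>The equations are paired with the complex conjugate of the lowest coefficient \<open>w\<close> of
  \<open>y\<close> and compared in the lowest degree that occurs, where only squares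
  \<open>\<bar>\<langle>v i, w\<rangle>\<bar>\<^sup>2\<close> remain.\<close>

private lemma least_squares_coeff_eq_0:
  assumes ls: "least_squares g y" and y: "\<And>j. order_ge m (y $ j)"
    and g: "\<And>i. i \<in> {1..n} \<Longrightarrow> has_lead (g i) m \<kappa>"
  shows "pcoeff (y $ j) m = 0"
proof -
  define w where "w = (\<chi> j. pcoeff (y $ j) m)"
  define z where "z i = cnj (pairing (v i) w)" for i
  have "w = 0"
  proof (rule ccontr)
    assume "w \<noteq> 0"
    have "\<exists>i\<in>{1..n}. z i \<noteq> 0"
    proof (rule ccontr)
      assume "\<not> ?thesis"
      then have "(\<chi> j. Re (w $ j)) = 0" "(\<chi> j. Im (w $ j)) = 0"
        using span[of "\<chi> j. Re (w $ j)"] span[of "\<chi> j. Im (w $ j)"]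
        by (auto simp: z_def simp flip: Re_pairing Im_pairing)
      then show False using \<open>w \<noteq> 0\<close> by (simp add: vec_eq_iff complex_eq_iff)
    qed
    then have ne: "l ` {i\<in>{1..n}. z i \<noteq> 0} \<noteq> {}" by blast
    define \<delta> where "\<delta> = Min (l ` {i\<in>{1..n}. z i \<noteq> 0})"
    have \<delta>_le: "\<delta> \<le> l i" if "i \<in> {1..n}" "z i \<noteq> 0" for i
      unfolding \<delta>_def using that by (intro Min_le) auto
    have "\<delta> \<in> l ` {i\<in>{1..n}. z i \<noteq> 0}" unfolding \<delta>_def using ne by (intro Min_in) auto
    then obtain k where k: "k \<in> {1..n}" "z k \<noteq> 0" "l k = \<delta>" by auto
    let ?D = "{i\<in>{1..n}. l i = \<delta>}"
    have diff: "has_lead (pairing (v i) y - g i) m (pairing (v i) w - \<kappa>)" if "i \<in> {1..n}" for i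
      using g[OF that] order_ge_pairing[of m y "v i"] y
      by (simp add: has_lead_def order_ge_diff pcoeff_pairing w_def)
    \<comment> \<open>Levels below \<delta> have z_i = 0, and levels above \<delta> contribute only
      in degrees above \<delta> + m.\<close>
    have summand: "z i * pcoeff (a i * (pairing (v i) y - g i)) (\<delta> + m) =
        (if l i = \<delta> then z i * (\<alpha> i * (pairing (v i) w - \<kappa>)) else 0)" if i: "i \<in> {1..n}" for i
    proof (cases "z i = 0 \<or> l i = \<delta>")
      case True
      then show ?thesis using diff[OF i] by (auto simp: pcoeff_pmonom_mult has_lead_def)
    next
      case False
      then have "\<delta> + m - l i < m" using \<delta>_le[OF i] by force
      then have "pcoeff (pairing (v i) y - g i) (\<delta> + m - l i) = 0"
        using diff[OF i] unfolding has_lead_def order_ge_def by blast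
      then show ?thesis using False by (simp only: pcoeff_pmonom_mult) simp
    qed
    \<comment> \<open>This is the coefficient of \<kappa>: a constant common to all
      \<open>g i\<close> drops out of the lowest degree. The real and imaginary parts of w see only
      indices with z_i nonzero, so \<delta> is low enough for both.\<close>
    have crit: "(\<Sum>i\<in>?D. pairing (v i) w * \<alpha> i) = 0"
    proof (rule complex_eqI)
      have nz: "z i \<noteq> 0" if "pairing (v i) (\<chi> j. Re (w $ j)) \<noteq> 0 \<or> pairing (v i) (\<chi> j. Im (w $ j)) \<noteq> 0" for i
        using that by (auto simp: z_def simp flip: Re_pairing Im_pairing)
      have "(\<Sum>i\<in>?D. pairing (v i) (\<chi> j. Re (w $ j)) * \<alpha> i) = 0"
        by (rule graded_crit) (use \<delta>_le nz in blast)
      then show "Re (\<Sum>i\<in>?D. pairing (v i) w * \<alpha> i) = Re 0"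
        by (simp add: Re_pairing)
      have "(\<Sum>i\<in>?D. pairing (v i) (\<chi> j. Im (w $ j)) * \<alpha> i) = 0"
        by (rule graded_crit) (use \<delta>_le nz in blast)
      then show "Im (\<Sum>i\<in>?D. pairing (v i) w * \<alpha> i) = Im 0"
        by (simp add: Im_pairing)
    qed
    have "0 = (\<Sum>i\<in>{1..n}. z i * pcoeff (a i * (pairing (v i) y - g i)) (\<delta> + m))"
      unfolding z_def pairing_cnj[symmetric]
      by (rule pairing_coeff_sum_eq_0[symmetric]) (use ls in \<open>simp only: least_squares_def\<close>)
    also have "\<dots> = (\<Sum>i\<in>{1..n}. if l i = \<delta> then z i * (\<alpha> i * (pairing (v i) w - \<kappa>)) else 0)"
      by (rule sum.cong[OF refl summand])
    also have "\<dots> = (\<Sum>i\<in>?D. z i * (\<alpha> i * (pairing (v i) w - \<kappa>)))"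
      by (simp only: sum.inter_filter finite_atLeastAtMost)
    also have "\<dots> = (\<Sum>i\<in>?D. of_real (\<alpha> i * (cmod (pairing (v i) w))\<^sup>2) - \<kappa> * cnj (pairing (v i) w * \<alpha> i))"
      by (intro sum.cong refl) (simp add: z_def complex_norm_square algebra_simps del: of_real_power)
    also have "\<dots> = of_real (\<Sum>i\<in>?D. \<alpha> i * (cmod (pairing (v i) w))\<^sup>2) - \<kappa> * cnj (\<Sum>i\<in>?D. pairing (v i) w * \<alpha> i)"
      by (simp only: sum_subtractf of_real_sum sum_distrib_left cnj_sum)
    also have "\<dots> = of_real (\<Sum>i\<in>?D. \<alpha> i * (cmod (pairing (v i) w))\<^sup>2)"
      unfolding crit by simp
    finally have "complex_of_real (\<Sum>i\<in>?D. \<alpha> i * (cmod (pairing (v i) w))\<^sup>2) = 0"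
      by (rule sym)
    then have "(\<Sum>i\<in>?D. \<alpha> i * (cmod (pairing (v i) w))\<^sup>2) = 0"
      by (simp only: of_real_eq_0_iff)
    moreover have "0 < (\<Sum>i\<in>?D. \<alpha> i * (cmod (pairing (v i) w))\<^sup>2)"
    proof (rule sum_pos2[of _ k])
      show "0 < \<alpha> k * (cmod (pairing (v k) w))\<^sup>2" using k \<alpha>_pos by (simp add: z_def)
      show "0 \<le> \<alpha> i * (cmod (pairing (v i) w))\<^sup>2" for i
        using less_imp_le[OF \<alpha>_pos] by simp
    qed (use k in auto)
    ultimately show False by simp
  qed
  then show ?thesis by (simp add: w_def vec_eq_iff)
qed

text \<open>If the lowest exponent of y were below m, all data would have coefficient 0 there, and
  so would y.\<close>

private lemma least_squares_order_ge:
  assumes ls: "least_squares g y" and g: "\<And>i. i \<in> {1..n} \<Longrightarrow> order_ge m (g i)"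
  shows "order_ge m (y $ j)"
  unfolding order_ge_def
proof (intro allI impI, rule ccontr)
  fix x assume x: "x < m" "pcoeff (y $ j) x \<noteq> 0"
  then obtain m' k where m': "m' \<le> x" "pcoeff (y $ k) m' \<noteq> 0" "\<And>j. order_ge m' (y $ j)"
    using least_exponent by blast
  have "has_lead (g i) m' 0" if "i \<in> {1..n}" for i
    using g[OF that] m'(1) x(1) by (auto simp: has_lead_def order_ge_def)
  then show False using least_squares_coeff_eq_0[OF ls m'(3)] m'(2) by blast
qed

text \<open>In every degree up to 0 the constant -1 has one coefficient common to all i, which
  forces y to vanish there. This makes the first Newton step a genuine correction.\<close>

private lemma least_squares_order_pos:
  assumes ls: "least_squares (\<lambda>i. - 1) y"
  shows "\<exists>e>0. \<forall>j. order_ge e (y $ j)"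
proof (cases "y = 0")
  case True
  then show ?thesis by (intro exI[of _ 1]) simp
next
  case False
  then obtain j x where "pcoeff (y $ j) x \<noteq> 0"
    by (metis pcoeff_0 puiseux_eqI vec_eq_iff zero_index)
  then obtain m k where m: "pcoeff (y $ k) m \<noteq> 0" "\<And>j. order_ge m (y $ j)"
    using least_exponent by blast
  have "\<exists>\<kappa>. has_lead (- 1) m \<kappa>" if "m \<le> 0"
    using that by (auto simp: has_lead_def order_ge_def pcoeff_1)
  then have "0 < m" using least_squares_coeff_eq_0[OF ls m(2)] m(1) by (meson not_le)
  then show ?thesis using m(2) by blast
qed

text \<open>For data 0 the order bound holds for every m, so the Gram matrix has trivial kernel and
  is invertible over the field.\<close>

private lemma least_squares_solvable: "\<exists>y. least_squares g y"
proof -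
  define A :: "puiseux ^ 'r ^ 'r" where
    "A = (\<chi> j k. \<Sum>i\<in>{1..n}. a i * of_int (v i $ k) * of_int (v i $ j))"
  have A: "(A *v y) $ j = (\<Sum>i\<in>{1..n}. a i * pairing (v i) y * of_int (v i $ j))" for y j
  proof -
    have inner: "(\<Sum>k\<in>UNIV. a i * of_int (v i $ k) * of_int (v i $ j) * y $ k) =
        a i * pairing (v i) y * of_int (v i $ j)" for i
      unfolding pairing_def sum_distrib_left sum_distrib_right by (rule sum.cong) (simp_all only: mult_ac)
    have "(A *v y) $ j = (\<Sum>k\<in>UNIV. \<Sum>i\<in>{1..n}. a i * of_int (v i $ k) * of_int (v i $ j) * y $ k)"
      by (simp only: A_def matrix_vector_mult_def vec_lambda_beta sum_distrib_right)
    also have "\<dots> = (\<Sum>i\<in>{1..n}. \<Sum>k\<in>UNIV. a i * of_int (v i $ k) * of_int (v i $ j) * y $ k)"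
      by (rule sum.swap)
    finally show ?thesis unfolding inner .
  qed
  have "y = 0" if "A *v y = 0" for y
  proof -
    have "least_squares (\<lambda>_. 0) y"
      using A[of y] that by (simp add: least_squares_def)
    then have "order_ge m (y $ j)" for m j by (rule least_squares_order_ge) simp
    then show ?thesis using eq_0_if_order_ge_multiples[of 1] by (simp add: vec_eq_iff)
  qed
  then have "\<exists>B. B ** A = mat 1" by (intro matrix_left_invertible_ker[THEN iffD2] allI impI)
  then obtain B where "B ** A = mat 1" ..
  then have AB: "A ** B = mat 1" by (rule matrix_left_right_inverse[THEN iffD1])
  define b where "b = (\<chi> j. \<Sum>i\<in>{1..n}. a i * g i * of_int (v i $ j))"
  have "A *v (B *v b) = b" by (simp add: matrix_vector_mul_assoc AB)
  then have "(\<Sum>i\<in>{1..n}. a i * pairing (v i) (B *v b) * of_int (v i $ j)) =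
      (\<Sum>i\<in>{1..n}. a i * g i * of_int (v i $ j))" for j
    unfolding A[symmetric] by (simp only: b_def vec_lambda_beta)
  then have "least_squares g (B *v b)"
    unfolding least_squares_def right_diff_distrib left_diff_distrib sum_subtractf by simp
  then show ?thesis by blast
qed

text \<open>Fixed points of \<open>h \<mapsto> T (\<langle>v i, h\<rangle> - (1 + h) ^ v i)\<close>, with \<open>T\<close> the least squares
  solution, are critical points; this map contracts by \<open>t\<^sup>e\<close>.\<close>

lemma hensel_critical_point:
  "\<exists>h e. 0 < e \<and> (\<forall>j. order_ge e (h $ j)) \<and>
     (\<forall>j. (\<Sum>i\<in>{1..n}. a i * laurent_monomial (v i) (1 + h) * of_int (v i $ j)) = 0)"
proof -
  obtain T where T: "\<And>g. least_squares g (T g)" using least_squares_solvable by metis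
  define G where "G h i = pairing (v i) h - laurent_monomial (v i) (1 + h)" for h :: "puiseux ^ 'r" and i
  define h where "h k = ((\<lambda>h. T (G h)) ^^ k) 0" for k :: nat
  have h_0: "h 0 = 0" and h_Suc: "h (Suc k) = T (G (h k))" for k by (simp_all add: h_def)
  have G_0: "G (h 0) = (\<lambda>i. - 1)" by (simp add: G_def h_0 fun_eq_iff)
  have "least_squares (\<lambda>i. - 1) (h 1)" using T[of "G (h 0)"] h_Suc[of 0] G_0 by simp
  then obtain e where e: "0 < e" "\<And>j. order_ge e (h 1 $ j)"
    using least_squares_order_pos by blast
  \<comment> \<open>\<open>G\<close> removes the linear part of the monomial, so its variation is
    the error term of \<open>log_diff\<close>, which gains e over the variation of h.\<close>
  have G_diff: "order_ge (m + e) (G x i - G y i)"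
    if "\<And>j. order_ge e (x $ j)" "\<And>j. order_ge e (y $ j)" "\<And>j. order_ge m ((x - y) $ j)" for m x y i
  proof -
    have "log_diff e m (laurent_monomial (v i) (1 + x)) (laurent_monomial (v i) (1 + y)) (pairing (v i) (x - y))"
      by (rule log_diff_laurent_monomial[OF e(1)])
         (use that in \<open>simp add: log_diff_def order_ge_uminus\<close>)
    then have "order_ge (m + e) (- (laurent_monomial (v i) (1 + x) - laurent_monomial (v i) (1 + y) - pairing (v i) (x - y)))"
      unfolding log_diff_def by (blast intro: order_ge_uminus)
    then show ?thesis by (simp add: G_def pairing_diff algebra_simps)
  qed
  have step: "(\<forall>j. order_ge e (h k $ j)) \<and> (\<forall>j. order_ge (real (Suc k) * e) ((h (Suc k) - h k) $ j))" for k
  proof (induction k)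
    case 0
    then show ?case using e(2) by (simp add: h_0)
  next
    case (Suc k)
    have "e \<le> real (Suc k) * e" using e(1) by (simp add: distrib_right)
    then have "order_ge e ((h (Suc k) - h k) $ j + h k $ j)" for j
      using Suc order_ge_mono by (intro order_ge_add) blast+
    then have near: "order_ge e (h (Suc k) $ j)" for j by simp
    have "order_ge (real (Suc k) * e + e) (G (h (Suc k)) i - G (h k) i)" for i
      using near Suc by (intro G_diff) auto
    then have "order_ge (real (Suc k) * e + e) ((T (G (h (Suc k))) - T (G (h k))) $ j)" for j
      by (rule least_squares_order_ge[OF least_squares_diff[OF T T]])
    then show ?case using near by (simp add: h_Suc algebra_simps)
  qed
  have "\<exists>g. \<forall>k. order_ge (real k * e) (g - h k $ j)" for j
  proof (rule puiseux_Cauchy_limit[OF e(1)])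
    fix k
    have "order_ge (real (Suc k) * e) (h (Suc k) $ j - h k $ j)" using step[of k] by simp
    then show "order_ge (real k * e) (h (Suc k) $ j - h k $ j)"
      by (rule order_ge_mono) (use e(1) in simp)
  qed
  then obtain H' where "\<And>j k. order_ge (real k * e) (H' j - h k $ j)" by metis
  moreover define H where "H = (\<chi> j. H' j)"
  ultimately have H: "order_ge (real k * e) ((H - h k) $ j)" for k j by simp
  have near: "order_ge e (H $ j)" for j
    using order_ge_add[OF _ e(2), of "(H - h 1) $ j" j] H[of 1] by simp
  \<comment> \<open>Both series agree with \<open>h (Suc k)\<close> up to order k e, for every
    k.\<close>
  have "(T (G H) - H) $ j = 0" for j
  proof (rule eq_0_if_order_ge_multiples[OF e(1)])
    fix k
    have "order_ge (real k * e) (G H i - G (h k) i)" for i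
      using order_ge_mono[OF G_diff[OF near _ H]] step e(1) by simp
    then have "order_ge (real k * e) ((T (G H) - h (Suc k)) $ j)"
      unfolding h_Suc by (rule least_squares_order_ge[OF least_squares_diff[OF T T]])
    moreover have "order_ge (real k * e) ((H - h (Suc k)) $ j)"
      using H[of "Suc k"] by (rule order_ge_mono) (use e(1) in simp)
    ultimately have "order_ge (real k * e) ((T (G H) - h (Suc k)) $ j - (H - h (Suc k)) $ j)"
      by (rule order_ge_diff)
    then show "order_ge (real k * e) ((T (G H) - H) $ j)" by simp
  qed
  then have "T (G H) = H" by (simp add: vec_eq_iff)
  \<comment> \<open>At a fixed point <v_i,H> - \<open>G H i\<close> is the monomial itself, so the
    normal equations become the critical equations.\<close>
  then have "least_squares (G H) H" using T[of "G H"] by simp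
  then have "(\<Sum>i\<in>{1..n}. a i * laurent_monomial (v i) (1 + H) * of_int (v i $ j)) = 0" for j
    by (simp add: least_squares_def G_def)
  then show ?thesis using near e(1) by blast
qed

end

section \<open>Return to the torus and conclusion\<close>

lemma balanced_imp_positive_critical_point:
  fixes v :: "nat \<Rightarrow> int ^ 'r"
  assumes bal: "balanced n v c d"
  shows "\<exists>p\<in>torus_pos. critical_point (superpotential n v c) p \<and> (\<forall>w. val (p w) = pairing w d)"
proof -
  let ?l = "\<lambda>i. ell v c i d"
  have bal': "\<exists>i\<in>{1..n}. 0 < real_vec (v i) \<bullet> u \<and> (\<forall>j\<in>{1..n}. real_vec (v j) \<bullet> u \<noteq> 0 \<longrightarrow> ?l i \<le> ?l j)"
    if "u \<noteq> 0" for u :: "real ^ 'r"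
    using bal that by (simp add: balanced_def pairing_inner)
  obtain b where b: "\<forall>u \<delta>. (\<forall>i\<in>{1..n}. real_vec (v i) \<bullet> u \<noteq> 0 \<longrightarrow> \<delta> \<le> ?l i) \<longrightarrow>
      (\<Sum>i\<in>{i\<in>{1..n}. ?l i = \<delta>}. (real_vec (v i) \<bullet> u) * exp (real_vec (v i) \<bullet> b)) = 0"
    using graded_exp_sum_critical_point[OF finite_atLeastAtMost bal'] by blast
  let ?a = "\<lambda>i. pmonom (of_real (exp (pairing (v i) b))) (?l i)"
  have "\<exists>h e. 0 < e \<and> (\<forall>j. order_ge e (h $ j)) \<and>
     (\<forall>j. (\<Sum>i\<in>{1..n}. ?a i * laurent_monomial (v i) (1 + h) * of_int (v i $ j)) = 0)"
  proof (rule hensel_critical_point)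
    show "\<exists>i\<in>{1..n}. pairing (v i) u \<noteq> 0" if "u \<noteq> 0" for u :: "real ^ 'r"
      using bal'[OF that] by (force simp: pairing_inner)
    show "(\<Sum>i\<in>{i\<in>{1..n}. ?l i = \<delta>}. pairing (v i) u * exp (pairing (v i) b)) = 0"
      if "\<And>i. i \<in> {1..n} \<Longrightarrow> pairing (v i) u \<noteq> 0 \<Longrightarrow> \<delta> \<le> ?l i" for u :: "real ^ 'r" and \<delta>
      using b that by (simp add: pairing_inner)
  qed simp
  then obtain h e where e: "0 < e" "\<And>j. order_ge e (h $ j)"
    and crit: "\<And>j. (\<Sum>i\<in>{1..n}. ?a i * laurent_monomial (v i) (1 + h) * of_int (v i $ j)) = 0"
    by blast
  \<comment> \<open>The point is t^d e^b (1 + h): valuation, leading coefficient and higher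
    corrections as separate homomorphisms.\<close>
  define p where "p w = pmonom (of_real (exp (pairing w b))) (pairing w d) * laurent_monomial w (1 + h)" for w
  have near: "has_lead ((1 + h) $ j) 0 1" for j
    using has_lead_if_near_1[OF e(1), of "(1 + h) $ j"] e(2) by simp
  have lead: "has_lead (p w) (pairing w d) (of_real (exp (pairing w b)))" for w
  proof -
    have "has_lead (laurent_monomial w (1 + h)) (pairing w 0) (of_real (exp (pairing w 0)))"
      by (rule has_lead_laurent_monomial) (use near in simp)
    moreover have "has_lead (pmonom (of_real (exp (pairing w b))) (pairing w d)) (pairing w d) (of_real (exp (pairing w b)))"
      by (simp add: has_lead_def order_ge_def pcoeff_pmonom)
    ultimately show ?thesis using has_lead_mult unfolding p_def by fastforce
  qed
  have val: "val (p w) = pairing w d" for w by (rule val_eqI[OF lead]) simp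
  have nz: "p w \<noteq> 0" for w by (rule has_lead_nonzero[OF lead]) simp
  have pair_add: "pairing (w + w') x = pairing w x + pairing w' x" for w w' and x :: "real ^ 'r"
    by (simp add: pairing_def distrib_right sum.distrib)
  have h1: "(1 + h) $ j \<noteq> 0" for j using near has_lead_nonzero by force
  have "p (w + w') = p w * p w'" for w w'
    unfolding p_def laurent_monomial_add[of "1 + h", OF h1] pair_add
    using pmonom_mult[of "of_real (exp (pairing w b))" "pairing w d" "of_real (exp (pairing w' b))" "pairing w' d"]
    by (simp add: exp_add mult_ac)
  then have "p \<in> torus_pos"
    using nz val lead unfolding torus_pos_def torus_def puiseux_pos_def
    by (auto simp: has_lead_def intro!: exI[of _ "exp _"])
  moreover have "critical_point (superpotential n v c) p"
    unfolding critical_point_superpotential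
  proof
    fix u :: "int ^ 'r"
    \<comment> \<open>Since c_i + <v_i,d> is the level of i, t^(c_i) p^(v_i) is \<open>?a i\<close>
      times the monomial in 1 + h. The equation for u then combines the coordinate equations with
      the coefficients of u.\<close>
    have "tpow (c i) * of_int (pairing (v i) u) * p (v i) =
        (\<Sum>j\<in>UNIV. of_int (u $ j) * (?a i * laurent_monomial (v i) (1 + h) * of_int (v i $ j)))" for i
    proof -
      have "tpow (c i) * p (v i) = ?a i * laurent_monomial (v i) (1 + h)"
        by (simp add: p_def tpow_eq_pmonom pmonom_mult ell_def add.commute flip: mult.assoc)
      then have "tpow (c i) * of_int (pairing (v i) u) * p (v i) =
          of_int (pairing (v i) u) * (?a i * laurent_monomial (v i) (1 + h))"
        by (simp add: mult_ac)
      then show ?thesis by (simp add: pairing_def sum_distrib_left sum_distrib_right mult_ac)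
    qed
    then have "(\<Sum>i\<in>{1..n}. tpow (c i) * of_int (pairing (v i) u) * p (v i)) =
      (\<Sum>j\<in>UNIV. of_int (u $ j) * (\<Sum>i\<in>{1..n}. ?a i * laurent_monomial (v i) (1 + h) * of_int (v i $ j)))"
      unfolding sum_distrib_left by (simp only: sum.swap[of _ UNIV])
    then show "(\<Sum>i\<in>{1..n}. tpow (c i) * of_int (pairing (v i) u) * p (v i)) = 0"
      by (simp only: crit) simp
  qed
  ultimately show ?thesis using val by blast
qed

lemma val_torus_eqI:
  fixes d :: "real ^ 'r"
  assumes "\<And>w. val (p w) = pairing w d"
  shows "val_torus p = d"
  unfolding val_torus_def
proof (rule the_equality)
  fix d' :: "real ^ 'r" assume "\<forall>w. val (p w) = pairing w d'"
  then have "pairing (axis j 1) d' = pairing (axis j 1) d" for j using assms by metis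
  moreover have "pairing (axis j 1) x = x $ j" for j and x :: "real ^ 'r"
  proof -
    have "pairing (axis j 1) x = (\<Sum>k\<in>UNIV. if k = j then x $ k else 0)"
      unfolding pairing_def by (rule sum.cong) (auto simp: axis_def)
    then show ?thesis by simp
  qed
  ultimately show "d' = d" by (simp add: vec_eq_iff)
qed (use assms in blast)

theorem lemma7p1:
  fixes P :: "(real ^ 'r) set"
    and n :: nat
    and v :: "nat \<Rightarrow> int ^ 'r"
    and c :: "nat \<Rightarrow> real"
  assumes "delzant P"
    and "facet_presentation n v c P"
  shows "d_crit (superpotential n v c) = fooo_point n v c P \<and>
    {val_torus p | p. p \<in> torus_pos \<and> critical_point (superpotential n v c) p}
      = {fooo_point n v c P}"
proof -
  let ?W = "superpotential n v c"
  have bal: "balanced n v c (fooo_point n v c P)"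
    by (rule fooo_point_balanced)
       (use assms in \<open>auto simp: delzant_def facet_presentation_def primitive_def\<close>)
  then obtain p where p: "p \<in> torus_pos" "critical_point ?W p"
    and val: "\<And>w. val (p w) = pairing w (fooo_point n v c P)"
    using balanced_imp_positive_critical_point by blast
  have span: "\<exists>i\<in>{1..n}. pairing (v i) u \<noteq> 0" if "u \<noteq> 0" for u :: "real ^ 'r"
    using bal that unfolding balanced_def by force
  have unique: "p' = p" if "p' \<in> torus_pos" "critical_point ?W p'" for p'
    by (rule positive_critical_point_unique[OF span that p])
  have val_p: "val_torus p = fooo_point n v c P" using val by (rule val_torus_eqI)
  have "p_crit ?W = p"
    unfolding p_crit_def using p unique by (intro the_equality) blast+
  then have "d_crit ?W = fooo_point n v c P" by (simp add: d_crit_def val_p)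
  moreover have "{val_torus q | q. q \<in> torus_pos \<and> critical_point ?W q} = {fooo_point n v c P}"
    unfolding val_p[symmetric]
  proof (intro equalityI subsetI)
    fix x assume "x \<in> {val_torus q | q. q \<in> torus_pos \<and> critical_point ?W q}"
    then show "x \<in> {val_torus p}" using unique by blast
  qed (use p in blast)
  ultimately show ?thesis ..
qed

end
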